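(* Let $X$ be a real random variable with $\mathbb{E}X=0$, $\mathbb{E}X^2=1$, $\mathbb{E}X^4<\infty$, and put $v=\mathbb{E}X^4-1$. For each $n$ let $1\le d=d_n\le n$ be an integer, $p=\binom nd$, and $N=N_n\ge1$ an integer, and assume that as $n\to\infty$, $d^2/n\to\lambda\in[0,\infty)$ and $p/N\to c\in(0,\infty)$. Let $X_1,\dots,X_n$ be i.i.d. copies of $X$, put $\delta_i=X_i^2-1$, $a_n=d/n$, \[ R_n=\frac1{\binom nd}\sum_{I\subseteq[n],\,|I|=d}\ \prod_{i\in I}X_i^2,\qquad P_n=\prod_{i=1}^n(1+a_n\delta_i), \] and let $R=\exp\bigl(\sqrt{\lambda v}\,Z-\tfrac{\lambda v}{2}\bigr)$ with $Z\sim N(0,1)$. Then, as $n\to\infty$: (1) $\log P_n\Rightarrow N\bigl(-\tfrac{\lambda v}{2},\lambda v\bigr)$; (2) $R_n\Rightarrow R$, and in fact $R_n/P_n\to1$ in probability; (3) the law of $R_n$ converges to the law of $R$ in the Wasserstein distance $W_2$, and $\mathbb{E}R_n^2\to e^{\lambda v}$.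
   Context: $\Rightarrow$ denotes convergence in distribution. $N(m,\sigma^2)$ is the normal law with mean $m$ and variance $\sigma^2$; $N(0,0)=\delta_0$. For all sufficiently large $n$ one has $a_n<1$ and then $P_n>0$, so $\log P_n$ is well defined for all large $n$. $W_2$ is the quadratic Wasserstein distance between probability measures on $\mathbb{R}$ with finite second moment. $[n]=\{1,\dots,n\}$. (The quantity $R_n$ is $\|x\|^2/p$ for the vector $x=(\prod_{i\in I}X_i)_{|I|=d}$.) *)

theory Defs
  imports "HOL-Probability.Probability"
begin

definition normal_law :: "real \<Rightarrow> real \<Rightarrow> real measure" where
  "normal_law m s2 =
     (if s2 = 0 then return borel m
      else density lborel (\<lambda>x. ennreal (normal_density m (sqrt s2) x)))"

definition R_stat :: "nat \<Rightarrow> nat \<Rightarrow> (nat \<Rightarrow> real) \<Rightarrow> real" where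
  "R_stat n d x =
     (\<Sum>I | I \<subseteq> {1..n} \<and> card I = d. \<Prod>i\<in>I. (x i)\<^sup>2) / real (n choose d)"

definition P_stat :: "nat \<Rightarrow> nat \<Rightarrow> (nat \<Rightarrow> real) \<Rightarrow> real" where
  "P_stat n d x = (\<Prod>i\<in>{1..n}. 1 + (real d / real n) * ((x i)\<^sup>2 - 1))"

text \<open>The \<open>n\<close>-th random variable lives on its own probability space \<open>M n\<close>;
  no joint law across different \<open>n\<close> is involved when the limit is a constant.\<close>

definition converges_in_prob_const ::
    "(nat \<Rightarrow> 'a measure) \<Rightarrow> (nat \<Rightarrow> 'a \<Rightarrow> real) \<Rightarrow> real \<Rightarrow> bool" where
  "converges_in_prob_const M Y c \<longleftrightarrow>
     (\<forall>\<epsilon>>0. (\<lambda>n. measure (M n) {\<omega> \<in> space (M n). \<bar>Y n \<omega> - c\<bar> > \<epsilon>}) \<longlonglongrightarrow> 0)"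

definition couplings :: "real measure \<Rightarrow> real measure \<Rightarrow> (real \<times> real) measure set" where
  "couplings \<mu> \<nu> =
     {\<gamma>. sets \<gamma> = sets (borel \<Otimes>\<^sub>M borel) \<and> prob_space \<gamma> \<and>
         distr \<gamma> borel fst = \<mu> \<and> distr \<gamma> borel snd = \<nu>}"

text \<open>The value is extended: an infinite optimal cost gives \<open>\<infinity>\<close>, not the
  junk value that \<open>enn2real \<infinity> = 0\<close> would produce. It is finite whenever both
  measures have a finite second moment.\<close>

definition wasserstein2 :: "real measure \<Rightarrow> real measure \<Rightarrow> ennreal" where
  "wasserstein2 \<mu> \<nu> =
     (let cost = (INF \<gamma>\<in>couplings \<mu> \<nu>. \<integral>\<^sup>+ z. ennreal ((fst z - snd z)\<^sup>2) \<partial>\<gamma>)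
      in if cost = \<infinity> then \<infinity> else ennreal (sqrt (enn2real cost)))"

end

theory Submission
  imports Defs "HOL-Real_Asymp.Real_Asymp"
begin

text \<open>
  Put \<open>\<delta>\<^sub>i = X\<^sub>i\<^sup>2 - 1\<close>, a centred variable with variance \<open>v\<close>, and \<open>a = d / n\<close>. Writing each
  \<open>X\<^sub>i\<^sup>2\<close> as \<open>1 + \<delta>\<^sub>i\<close> and multiplying out turns both statistics into sums over all subsets \<open>J\<close>
  of \<open>{1..n}\<close> of the products \<open>\<delta>\<^sub>J = \<Prod>j\<in>J. \<delta>\<^sub>j\<close>: the weight of \<open>\<delta>\<^sub>J\<close> with \<open>k = card J\<close> is \<open>a ^ k\<close> in
  \<open>P\<^sub>n\<close>, and the fraction \<open>b\<^sub>k = (d choose k) / (n choose k)\<close> of \<open>d\<close>-subsets that contain \<open>J\<close> in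
  \<open>R\<^sub>n\<close> (lemmas \<open>P_stat_eq_sum\<close>, \<open>R_stat_eq_sum\<close>). The \<open>\<delta>\<^sub>J\<close> are orthogonal with
  \<open>E \<delta>\<^sub>J\<^sup>2 = v ^ k\<close>, so all second moments are explicit sums over \<open>k\<close>.

  The terms \<open>(n choose k) b\<^sub>k\<^sup>2 v ^ k\<close> of \<open>E R\<^sub>n\<^sup>2\<close> converge to \<open>(\<lambda> v) ^ k / k!\<close> under a summable
  bound, so \<open>E R\<^sub>n\<^sup>2\<close> tends to \<open>exp (\<lambda> v)\<close> (lemma \<open>sum_square_binomial_ratio_limit\<close>). On the other
  side \<open>E P\<^sub>n\<^sup>2 = (1 + a\<^sup>2 v) ^ n \<le> exp (n a\<^sup>2 v)\<close>, with the same limit. As \<open>0 \<le> b\<^sub>k \<le> a ^ k\<close>,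
  orthogonality gives \<open>E (R\<^sub>n - P\<^sub>n)\<^sup>2 \<le> E P\<^sub>n\<^sup>2 - E R\<^sub>n\<^sup>2\<close>, which tends to 0. Hence \<open>R\<^sub>n\<close> may be
  replaced by the product \<open>P\<^sub>n\<close>.

  The logarithm of \<open>P\<^sub>n\<close> is a sum of \<open>n\<close> independent copies of \<open>ln (1 + a \<delta>)\<close>, so its
  characteristic function at \<open>t\<close> is an \<open>n\<close>-th power. Since \<open>(1 + x) powr (\<i>t)\<close> equals
  \<open>1 + \<i>tx - (t\<^sup>2 + \<i>t) x\<^sup>2 / 2\<close> up to \<open>o(x\<^sup>2)\<close>, and \<open>\<delta>\<close> is centred, dominated convergence
  gives the limit \<open>exp (- \<lambda>v (t\<^sup>2 + \<i>t) / 2)\<close> (lemmas \<open>log_increment_char_limit\<close> and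
  \<open>power_tendsto_exp_complex\<close>). This is the characteristic function of the normal law with mean
  \<open>- \<lambda>v/2\<close> and variance \<open>\<lambda>v\<close>; only the second moment of \<open>\<delta>\<close> enters.

  The rest is soft. The same independence bounds \<open>E P\<^sub>n\<^sup>-\<^sup>2\<close>, so closeness in mean square implies
  \<open>R\<^sub>n / P\<^sub>n \<rightarrow> 1\<close> in probability (lemma \<open>ratio_deviation_bound\<close>). Exponentiating the limit law of
  \<open>ln P\<^sub>n\<close> and comparing characteristic functions gives the limit law of \<open>R\<^sub>n\<close>. Finally
  \<open>E R\<^sup>2 = exp (\<lambda> v)\<close> too, and weak convergence with convergent second moments is convergence in
  \<open>W\<^sub>2\<close> (lemma \<open>wasserstein2_tendsto_0\<close>).
\<close>

section \<open>Ratios of binomial coefficients\<close>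

lemma binomial_eq_prod_real:
  "real (m choose k) = (\<Prod>i<k. real m - real i) / fact k"
  by (simp add: binomial_gbinomial gbinomial_prod_rev atLeast0LessThan)

text \<open>
  The ratio is the product over \<open>i < k\<close> of \<open>(d - i) / (n - i)\<close>, and each factor is at most its
  value at \<open>i = 0\<close> because \<open>d \<le> n\<close>.
\<close>
lemma binomial_ratio_le_power:
  assumes "d \<le> n"
  shows "real (d choose k) / real (n choose k) \<le> (real d / real n) ^ k"
proof (cases "k \<le> d")
  case True
  have "real (d choose k) / real (n choose k) = (\<Prod>i<k. (real d - real i) / (real n - real i))"
    by (simp add: binomial_eq_prod_real prod_dividef)
  also have "\<dots> \<le> (\<Prod>i<k. real d / real n)"
  proof (rule prod_mono, safe)
    fix i assume "i < k"
    with True assms have *: "real i < real d" "real d \<le> real n" by auto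
    then show "0 \<le> (real d - real i) / (real n - real i)" by simp
    from * have "real i * real d \<le> real i * real n" by (intro mult_left_mono) auto
    with * show "(real d - real i) / (real n - real i) \<le> real d / real n"
      by (simp add: field_simps)
  qed
  finally show ?thesis by simp
qed (simp add: not_le binomial_eq_0)

lemma square_binomial_ratio_eq_prod:
  assumes "k \<le> n"
  shows "(real (d choose k))\<^sup>2 / real (n choose k)
    = (\<Prod>i<k. (real d - real i)\<^sup>2 / (real n - real i)) / fact k"
proof -
  have "(\<Prod>i<k. real n - real i) \<noteq> 0"
    using assms by (auto simp: prod_zero_iff)
  then show ?thesis
    by (simp add: binomial_eq_prod_real prod_dividef power2_eq_square prod.distrib)
qed

text \<open>
  The left side is \<open>(n choose k) b\<^sub>k\<^sup>2\<close>. The bound is independent of \<open>n\<close> as soon as \<open>d\<^sup>2 / n\<close> is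
  bounded, and it is summable in \<open>k\<close>: it serves as the dominating sequence below.
\<close>
lemma square_binomial_ratio_bound:
  assumes "d \<le> n"
  shows "(real (d choose k))\<^sup>2 / real (n choose k) \<le> ((real d)\<^sup>2 / real n) ^ k / fact k"
proof (cases "k \<le> d")
  case True
  have "(\<Prod>i<k. (real d - real i)\<^sup>2 / (real n - real i)) \<le> (\<Prod>i<k. (real d)\<^sup>2 / real n)"
  proof (rule prod_mono, safe)
    fix i assume "i < k"
    with True assms have *: "real i < real d" "real d \<le> real n" by auto
    then show "0 \<le> (real d - real i)\<^sup>2 / (real n - real i)" by simp
    from * have "real i * real d \<le> real i * real n" by (intro mult_left_mono) auto
    with * have "(real d - real i) / (real n - real i) \<le> real d / real n"
      by (simp add: field_simps)
    then have "(real d - real i) * ((real d - real i) / (real n - real i))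
        \<le> real d * (real d / real n)"
      using * by (intro mult_mono) auto
    then show "(real d - real i)\<^sup>2 / (real n - real i) \<le> (real d)\<^sup>2 / real n"
      by (simp add: power2_eq_square)
  qed
  then show ?thesis
    using square_binomial_ratio_eq_prod[of k n d] True assms by (simp add: divide_right_mono)
qed (simp add: not_le binomial_eq_0)

text \<open>
  The square of \<open>d / n\<close> is \<open>d\<^sup>2 / n\<close> times \<open>1 / n\<close>.
\<close>
lemma ratio_tendsto_0:
  fixes d :: "nat \<Rightarrow> nat"
  assumes "(\<lambda>n. (real (d n))\<^sup>2 / real n) \<longlonglongrightarrow> lam"
  shows "(\<lambda>n. real (d n) / real n) \<longlonglongrightarrow> 0"
proof -
  have "(\<lambda>n. (real (d n))\<^sup>2 / real n * (1 / real n)) \<longlonglongrightarrow> lam * 0"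
    by (intro tendsto_mult assms lim_1_over_n)
  then have "(\<lambda>n. sqrt ((real (d n) / real n)\<^sup>2)) \<longlonglongrightarrow> sqrt 0"
    by (intro tendsto_real_sqrt) (simp add: power2_eq_square)
  then show ?thesis by simp
qed

text \<open>
  The index \<open>k\<close> is fixed, so the quotient is a product of \<open>k\<close> factors \<open>(d - i)\<^sup>2 / (n - i)\<close>. Each tends
  to \<open>\<lambda>\<close>, whether or not \<open>d\<close> tends to infinity, since the shift by \<open>i\<close> only changes terms of order
  \<open>d / n\<close> and \<open>1 / n\<close>.
\<close>
lemma square_binomial_ratio_limit:
  fixes d :: "nat \<Rightarrow> nat"
  assumes lim: "(\<lambda>n. (real (d n))\<^sup>2 / real n) \<longlonglongrightarrow> lam"
  shows "(\<lambda>n. (real (d n choose k))\<^sup>2 / real (n choose k)) \<longlonglongrightarrow> lam ^ k / fact k"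
proof -
  have factor: "(\<lambda>n. (real (d n) - real i)\<^sup>2 / (real n - real i)) \<longlonglongrightarrow> lam" for i
  proof -
    have "(\<lambda>n. ((real (d n))\<^sup>2 / real n - 2 * real i * (real (d n) / real n)
            + (real i)\<^sup>2 * (1 / real n)) * (real n / (real n - real i)))
          \<longlonglongrightarrow> (lam - 2 * real i * 0 + (real i)\<^sup>2 * 0) * 1"
    proof (intro tendsto_intros lim ratio_tendsto_0[OF lim] lim_1_over_n)
      show "(\<lambda>n. real n / (real n - real i)) \<longlonglongrightarrow> 1" by real_asymp
    qed
    moreover have "\<forall>\<^sub>F n in sequentially.
        ((real (d n))\<^sup>2 / real n - 2 * real i * (real (d n) / real n)
            + (real i)\<^sup>2 * (1 / real n)) * (real n / (real n - real i))
        = (real (d n) - real i)\<^sup>2 / (real n - real i)"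
      using eventually_gt_at_top[of i]
      by eventually_elim (simp add: field_simps power2_eq_square)
    ultimately have "(\<lambda>n. (real (d n) - real i)\<^sup>2 / (real n - real i))
        \<longlonglongrightarrow> (lam - 2 * real i * 0 + (real i)\<^sup>2 * 0) * 1"
      by (rule Lim_transform_eventually)
    then show ?thesis by simp
  qed
  have "(\<lambda>n. (\<Prod>i<k. (real (d n) - real i)\<^sup>2 / (real n - real i)) / fact k)
      \<longlonglongrightarrow> (\<Prod>i<k. lam) / fact k"
    by (intro tendsto_intros factor) simp
  moreover have "\<forall>\<^sub>F n in sequentially.
      (\<Prod>i<k. (real (d n) - real i)\<^sup>2 / (real n - real i)) / fact k
      = (real (d n choose k))\<^sup>2 / real (n choose k)"
    using eventually_ge_at_top[of k]
    by eventually_elim (simp add: square_binomial_ratio_eq_prod)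
  ultimately show ?thesis by (simp add: tendsto_cong)
qed

text \<open>
  Tannery's theorem: the terms converge to those of the exponential series, and eventually
  \<open>d\<^sup>2 / n < \<lambda> + 1\<close>, so \<open>((\<lambda> + 1) v) ^ k / k!\<close> dominates.
\<close>
lemma sum_square_binomial_ratio_limit:
  fixes d :: "nat \<Rightarrow> nat" and lam v :: real
  assumes lim: "(\<lambda>n. (real (d n))\<^sup>2 / real n) \<longlonglongrightarrow> lam"
    and le: "\<And>n. n \<ge> 1 \<Longrightarrow> d n \<le> n" and v: "v \<ge> 0"
  shows "(\<lambda>n. \<Sum>k\<le>n. (real (d n choose k))\<^sup>2 / real (n choose k) * v ^ k)
    \<longlonglongrightarrow> exp (lam * v)"
proof -
  define f where "f k n = (real (d n choose k))\<^sup>2 / real (n choose k) * v ^ k" for k n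
  have bound: "norm (f k n) \<le> ((lam + 1) * v) ^ k / fact k"
    if "n \<ge> 1" "(real (d n))\<^sup>2 / real n < lam + 1" for k n
  proof -
    have "(real (d n choose k))\<^sup>2 / real (n choose k) \<le> ((real (d n))\<^sup>2 / real n) ^ k / fact k"
      using le that by (intro square_binomial_ratio_bound) auto
    also have "\<dots> \<le> (lam + 1) ^ k / fact k"
      using that by (intro divide_right_mono power_mono) auto
    finally have "(real (d n choose k))\<^sup>2 / real (n choose k) * v ^ k
        \<le> (lam + 1) ^ k / fact k * v ^ k"
      using v by (intro mult_right_mono) auto
    then show ?thesis using v by (simp add: f_def power_mult_distrib)
  qed
  have "\<forall>\<^sub>F n in sequentially. (real (d n))\<^sup>2 / real n < lam + 1"
    using lim by (rule order_tendstoD) simp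
  then have "\<forall>\<^sub>F n in sequentially. n \<ge> 1 \<and> (real (d n))\<^sup>2 / real n < lam + 1"
    using eventually_ge_at_top[of 1] by eventually_elim simp
  then have "\<forall>\<^sub>F (k, n) in at_top \<times>\<^sub>F sequentially. norm (f k n) \<le> ((lam + 1) * v) ^ k / fact k"
    by (subst eventually_prod_filter)
       (rule exI[of _ "\<lambda>_. True"], rule exI, rule conjI[OF _ conjI], simp, assumption,
        use bound in auto)
  moreover have "summable (\<lambda>k. ((lam + 1) * v) ^ k / fact k)"
    using summable_exp[of "(lam + 1) * v"] by (simp add: field_simps)
  moreover have "f k \<longlonglongrightarrow> (lam * v) ^ k / fact k" for k
    using tendsto_mult_right[OF square_binomial_ratio_limit[OF lim], of k "v ^ k"]
    by (simp add: f_def[abs_def] power_mult_distrib)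
  ultimately have "(\<lambda>n. \<Sum>k. f k n) \<longlonglongrightarrow> (\<Sum>k. (lam * v) ^ k / fact k)"
    using tannerys_theorem[of f "\<lambda>k. (lam * v) ^ k / fact k" sequentially
        "\<lambda>k. ((lam + 1) * v) ^ k / fact k"] by simp
  also have "(\<Sum>k. (lam * v) ^ k / fact k) = exp (lam * v)"
    by (simp add: exp_def field_simps)
  finally have "(\<lambda>n. \<Sum>k. f k n) \<longlonglongrightarrow> exp (lam * v)" .
  moreover have "\<forall>\<^sub>F n in sequentially. (\<Sum>k. f k n) = (\<Sum>k\<le>n. f k n)"
    using eventually_ge_at_top[of 1]
  proof eventually_elim
    case (elim n)
    then show ?case
      using le[of n] by (intro suminf_finite) (auto simp: f_def)
  qed
  ultimately show ?thesis by (simp add: tendsto_cong f_def)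
qed

section \<open>Expanding the statistics over subsets\<close>

lemma sum_Pow_card:
  fixes f :: "nat \<Rightarrow> real"
  assumes "finite A"
  shows "(\<Sum>I\<in>Pow A. f (card I)) = (\<Sum>k\<le>card A. real (card A choose k) * f k)"
proof -
  have "(\<Sum>I\<in>Pow A. f (card I))
      = (\<Sum>k\<in>{..card A}. \<Sum>I\<in>{I \<in> Pow A. card I = k}. f (card I))"
    using assms by (intro sum.group[symmetric]) (auto intro: card_mono)
  also have "\<dots> = (\<Sum>k\<le>card A. real (card A choose k) * f k)"
    using n_subsets[OF assms] by (intro sum.cong) (simp_all add: Collect_conj_eq Pow_def)
  finally show ?thesis .
qed

lemma P_stat_eq_sum:
  "P_stat n d x = (\<Sum>J\<in>Pow {1..n}. (real d / real n) ^ card J * (\<Prod>j\<in>J. (x j)\<^sup>2 - 1))"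
  unfolding P_stat_def add.commute[of 1] 
  by (subst prod_add) (simp_all only: prod.distrib prod_constant power_one mult_1_right finite_atLeastAtMost)

lemma card_supersets_of_card:
  assumes A: "finite A" "J \<subseteq> A" and le: "card J \<le> d"
  shows "card {I. I \<subseteq> A \<and> card I = d \<and> J \<subseteq> I} = (card A - card J) choose (d - card J)"
proof -
  have finJ: "finite J" using A by (rule finite_subset[rotated])
  have "bij_betw (\<lambda>K. K \<union> J) {K. K \<subseteq> A - J \<and> card K = d - card J}
    {I. I \<subseteq> A \<and> card I = d \<and> J \<subseteq> I}"
  proof (rule bij_betwI[where g = "\<lambda>I. I - J"])
    show "(\<lambda>K. K \<union> J) \<in> {K. K \<subseteq> A - J \<and> card K = d - card J} \<rightarrow>
        {I. I \<subseteq> A \<and> card I = d \<and> J \<subseteq> I}"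
    proof safe
      fix K assume K: "K \<subseteq> A - J" "card K = d - card J"
      then have "finite K" "K \<inter> J = {}" using A by (auto intro: finite_subset)
      then show "card (K \<union> J) = d" using K le finJ by (simp add: card_Un_disjoint)
    qed (use A in auto)
    show "(\<lambda>I. I - J) \<in> {I. I \<subseteq> A \<and> card I = d \<and> J \<subseteq> I} \<rightarrow>
        {K. K \<subseteq> A - J \<and> card K = d - card J}"
      using finJ by (auto simp: card_Diff_subset)
  qed auto
  then have "card {I. I \<subseteq> A \<and> card I = d \<and> J \<subseteq> I}
      = card {K. K \<subseteq> A - J \<and> card K = d - card J}"
    by (rule bij_betw_same_card[symmetric])
  also have "\<dots> = card (A - J) choose (d - card J)"
    using A by (intro n_subsets) simp
  finally show ?thesis using A finJ by (simp add: card_Diff_subset)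
qed

text \<open>
  After expanding \<open>\<Prod>i\<in>I. 1 + \<delta>\<^sub>i\<close> for each \<open>d\<close>-subset \<open>I\<close>, exchange the sums: \<open>\<delta>\<^sub>J\<close> occurs once for
  each \<open>I\<close> that contains \<open>J\<close>, and \<open>(n choose d) (d choose k) = (n choose k) (n - k choose d - k)\<close> gives
  the weight. If \<open>card J > d\<close>, there is no such \<open>I\<close> and the weight is 0.
\<close>
lemma R_stat_eq_sum:
  assumes "d \<le> n"
  shows "R_stat n d x = (\<Sum>J\<in>Pow {1..n}.
    real (d choose card J) / real (n choose card J) * (\<Prod>j\<in>J. (x j)\<^sup>2 - 1))"
proof -
  let ?S = "{I. I \<subseteq> {1..n} \<and> card I = d}"
  let ?y = "\<lambda>J. \<Prod>j\<in>J. (x j)\<^sup>2 - 1"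
  have fin: "finite ?S" by (rule finite_subset[of _ "Pow {1..n}"]) auto
  have "(\<Sum>I\<in>?S. \<Prod>i\<in>I. (x i)\<^sup>2) = (\<Sum>I\<in>?S. \<Sum>J\<in>Pow I. ?y J)"
  proof (rule sum.cong[OF refl])
    fix I assume "I \<in> ?S"
    then have "finite I" by (auto intro: finite_subset)
    then show "(\<Prod>i\<in>I. (x i)\<^sup>2) = (\<Sum>J\<in>Pow I. ?y J)"
      using prod_add[of I "\<lambda>i. (x i)\<^sup>2 - 1" "\<lambda>_. 1"] by simp
  qed
  also have "\<dots> = (\<Sum>I\<in>?S. \<Sum>J\<in>{J \<in> Pow {1..n}. J \<subseteq> I}. ?y J)"
    by (intro sum.cong) auto
  also have "\<dots> = (\<Sum>J\<in>Pow {1..n}. \<Sum>I\<in>{I \<in> ?S. J \<subseteq> I}. ?y J)"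
    using fin by (rule sum.swap_restrict) simp
  also have "\<dots> = (\<Sum>J\<in>Pow {1..n}. real (n choose d) * (real (d choose card J) / real (n choose card J)) * ?y J)"
  proof (rule sum.cong[OF refl])
    fix J assume "J \<in> Pow {1..n}"
    then have J: "J \<subseteq> {1..n}" "finite J" by (auto intro: finite_subset)
    then have le: "card J \<le> n" using card_mono[of "{1..n}" J] by simp
    have "real (card {I \<in> ?S. J \<subseteq> I}) * real (n choose card J)
      = real (n choose d) * real (d choose card J)"
    proof (cases "card J \<le> d")
      case False
      have "card J \<le> card I" if "I \<in> ?S" "J \<subseteq> I" for I
        using that by (intro card_mono) (auto intro: finite_subset)
      with False have "{I \<in> ?S. J \<subseteq> I} = {}" by auto
      then have "card {I \<in> ?S. J \<subseteq> I} = 0" by simp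
      with False show ?thesis by (simp add: binomial_eq_0)
    next
      case True
      have "card {I \<in> ?S. J \<subseteq> I} = (n - card J) choose (d - card J)"
        using card_supersets_of_card[OF _ J(1) True] by (simp add: conj_assoc)
      then show ?thesis
        using choose_mult[OF True assms] by (simp flip: of_nat_mult add: mult.commute)
    qed
    then have "real (card {I \<in> ?S. J \<subseteq> I})
      = real (n choose d) * (real (d choose card J) / real (n choose card J))"
      using le by (simp add: field_simps)
    then show "(\<Sum>I\<in>{I \<in> ?S. J \<subseteq> I}. ?y J)
        = real (n choose d) * (real (d choose card J) / real (n choose card J)) * ?y J"
      by simp
  qed
  also have "\<dots> = real (n choose d) * (\<Sum>J\<in>Pow {1..n}.
      real (d choose card J) / real (n choose card J) * ?y J)"
    by (simp only: mult.assoc sum_distrib_left)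
  finally show ?thesis
    using assms unfolding R_stat_def by (simp only:) simp
qed

section \<open>Orthogonality of products of independent variables\<close>

text \<open>
  The finite stage of the triangular array: \<open>n\<close> independent centred variables with common variance.
\<close>
locale independent_centered = prob_space +
  fixes n :: nat and D :: "nat \<Rightarrow> 'a \<Rightarrow> real" and v :: real
  assumes indep: "indep_vars (\<lambda>_. borel) D {1..n}"
    and square_integrable: "i \<in> {1..n} \<Longrightarrow> integrable M (\<lambda>\<omega>. (D i \<omega>)\<^sup>2)"
    and mean_zero: "i \<in> {1..n} \<Longrightarrow> expectation (D i) = 0"
    and second_moment: "i \<in> {1..n} \<Longrightarrow> expectation (\<lambda>\<omega>. (D i \<omega>)\<^sup>2) = v"
begin

lemma D_measurable [measurable]: "i \<in> {1..n} \<Longrightarrow> D i \<in> borel_measurable M"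
  using indep by (auto simp: indep_vars_def)

lemma D_integrable: "i \<in> {1..n} \<Longrightarrow> integrable M (D i)"
  using square_integrable_imp_integrable[OF D_measurable square_integrable] by simp

text \<open>
  A polynomial in the \<open>D\<^sub>i\<close> that is affine in each of them, with weights depending only on the degree:
  the linear combination \<open>\<Sum>k. w k * e\<^sub>k\<close> of elementary symmetric polynomials.
\<close>
definition level_sum :: "(nat \<Rightarrow> real) \<Rightarrow> 'a \<Rightarrow> real" where
  "level_sum w \<omega> = (\<Sum>J\<in>Pow {1..n}. w (card J) * (\<Prod>j\<in>J. D j \<omega>))"

text \<open>
  The product of the two monomials factors over \<open>i \<in> {1..n}\<close> into \<open>D\<^sub>i\<^sup>2\<close>, \<open>D\<^sub>i\<close> or \<open>1\<close>, according to
  whether \<open>i\<close> lies in both sets, in one or in none. By independence the expectation is the product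
  of \<open>v\<close>, \<open>0\<close> and \<open>1\<close>, and a zero occurs exactly if the sets differ.
\<close>
lemma orthogonal_products:
  assumes I: "I \<subseteq> {1..n}" and J: "J \<subseteq> {1..n}"
  shows "integrable M (\<lambda>\<omega>. (\<Prod>i\<in>I. D i \<omega>) * (\<Prod>j\<in>J. D j \<omega>))" (is ?int)
    and "expectation (\<lambda>\<omega>. (\<Prod>i\<in>I. D i \<omega>) * (\<Prod>j\<in>J. D j \<omega>)) =
      (if I = J then v ^ card I else 0)" (is ?exp)
proof -
  define g where "g i x = (if i \<in> I then x else 1) * (if i \<in> J then x else 1)" for i and x :: real
  have prod_eq: "(\<Prod>i\<in>I. D i \<omega>) * (\<Prod>j\<in>J. D j \<omega>) = (\<Prod>i\<in>{1..n}. g i (D i \<omega>))" for \<omega>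
  proof -
    have "(\<Prod>i\<in>{1..n}. if i \<in> K then D i \<omega> else 1) = (\<Prod>i\<in>K. D i \<omega>)" if "K \<subseteq> {1..n}" for K
      using prod.inter_restrict[of "{1..n}" "\<lambda>i. D i \<omega>" K] Int_absorb1[OF that]
      by (simp only: finite_atLeastAtMost)
    with I J show ?thesis by (simp only: g_def prod.distrib)
  qed
  have "g i \<in> borel_measurable borel" for i
    by (cases "i \<in> I"; cases "i \<in> J") (simp_all add: g_def[abs_def])
  then have ind: "indep_vars (\<lambda>_. borel) (\<lambda>i \<omega>. g i (D i \<omega>)) {1..n}"
    by (rule indep_vars_compose2[OF indep])
  have int: "integrable M (\<lambda>\<omega>. g i (D i \<omega>))" if "i \<in> {1..n}" for i
    using square_integrable[OF that] D_integrable[OF that]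
    by (cases "i \<in> I"; cases "i \<in> J") (simp_all add: g_def power2_eq_square)
  show ?int
    unfolding prod_eq using ind int by (intro indep_vars_integrable) auto
  have "expectation (\<lambda>\<omega>. (\<Prod>i\<in>I. D i \<omega>) * (\<Prod>j\<in>J. D j \<omega>))
      = (\<Prod>i\<in>{1..n}. expectation (\<lambda>\<omega>. g i (D i \<omega>)))"
    unfolding prod_eq using ind int by (intro indep_vars_lebesgue_integral) auto
  also have "\<dots> = (\<Prod>i\<in>{1..n}. if i \<in> I then if i \<in> J then v else 0 else if i \<in> J then 0 else 1)"
    by (intro prod.cong refl)
       (auto simp: g_def mean_zero prob_space simp flip: second_moment power2_eq_square)
  also have "\<dots> = (if I = J then v ^ card I else 0)"
  proof (cases "I = J")
    case True
    have "(\<Prod>i\<in>{1..n}. if i \<in> I then v else 1) = v ^ card I"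
      using prod.inter_restrict[of "{1..n}" "\<lambda>_. v" I] Int_absorb1[OF I]
      by (simp only: finite_atLeastAtMost prod_constant)
    moreover have "(\<Prod>i\<in>{1..n}. if i \<in> I then if i \<in> J then v else 0 else if i \<in> J then 0 else 1)
        = (\<Prod>i\<in>{1..n}. if i \<in> I then v else 1)"
      using True by (intro prod.cong) auto
    ultimately show ?thesis using True by simp
  next
    case False
    then obtain i where "i \<in> I \<union> J" "i \<notin> I \<inter> J" by blast
    then have "\<exists>i\<in>{1..n}. (if i \<in> I then if i \<in> J then v else 0 else if i \<in> J then 0 else 1) = 0"
      using I J by (intro bexI[of _ i]) auto
    then have "(\<Prod>i\<in>{1..n}. if i \<in> I then if i \<in> J then v else 0 else if i \<in> J then 0 else 1) = 0"
      by (intro prod_zero) auto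
    with False show ?thesis by simp
  qed
  finally show ?exp .
qed

lemma level_sum_measurable [measurable]: "level_sum w \<in> borel_measurable M"
proof -
  have "(\<lambda>\<omega>. \<Prod>j\<in>J. D j \<omega>) \<in> borel_measurable M" if "J \<in> Pow {1..n}" for J
    using that by (intro borel_measurable_prod D_measurable) auto
  then show ?thesis unfolding level_sum_def[abs_def] by measurable
qed

lemma level_sum_square:
  shows "integrable M (\<lambda>\<omega>. (level_sum w \<omega>)\<^sup>2)" (is ?int)
    and "expectation (\<lambda>\<omega>. (level_sum w \<omega>)\<^sup>2) = (\<Sum>k\<le>n. real (n choose k) * ((w k)\<^sup>2 * v ^ k))"
      (is ?exp)
proof -
  let ?y = "\<lambda>J \<omega>. \<Prod>j\<in>J. D j \<omega>"
  have sq: "(level_sum w \<omega>)\<^sup>2 = (\<Sum>I\<in>Pow {1..n}. \<Sum>J\<in>Pow {1..n}.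
      w (card I) * w (card J) * (?y I \<omega> * ?y J \<omega>))" for \<omega>
    by (simp add: level_sum_def power2_eq_square sum_product mult_ac)
  have term_integrable: "integrable M (\<lambda>\<omega>. w (card I) * w (card J) * (?y I \<omega> * ?y J \<omega>))"
    if "I \<in> Pow {1..n}" "J \<in> Pow {1..n}" for I J
    using that by (intro integrable_mult_right orthogonal_products) auto
  show ?int
    unfolding sq by (intro Bochner_Integration.integrable_sum term_integrable)
  have "expectation (\<lambda>\<omega>. (level_sum w \<omega>)\<^sup>2) = (\<Sum>I\<in>Pow {1..n}. \<Sum>J\<in>Pow {1..n}.
      expectation (\<lambda>\<omega>. w (card I) * w (card J) * (?y I \<omega> * ?y J \<omega>)))"
  proof -
    have "expectation (\<lambda>\<omega>. (level_sum w \<omega>)\<^sup>2) = (\<Sum>I\<in>Pow {1..n}.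
        expectation (\<lambda>\<omega>. \<Sum>J\<in>Pow {1..n}. w (card I) * w (card J) * (?y I \<omega> * ?y J \<omega>)))"
      unfolding sq
      by (rule Bochner_Integration.integral_sum)
         (intro Bochner_Integration.integrable_sum term_integrable)
    also have "\<dots> = (\<Sum>I\<in>Pow {1..n}. \<Sum>J\<in>Pow {1..n}.
        expectation (\<lambda>\<omega>. w (card I) * w (card J) * (?y I \<omega> * ?y J \<omega>)))"
      by (intro sum.cong refl Bochner_Integration.integral_sum term_integrable)
    finally show ?thesis .
  qed
  also have "\<dots> = (\<Sum>I\<in>Pow {1..n}. \<Sum>J\<in>Pow {1..n}.
      if I = J then w (card I) * w (card I) * v ^ card I else 0)"
    by (intro sum.cong refl) (auto simp: orthogonal_products)
  also have "\<dots> = (\<Sum>I\<in>Pow {1..n}. (w (card I))\<^sup>2 * v ^ card I)"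
    by (simp add: power2_eq_square)
  also have "\<dots> = (\<Sum>k\<le>n. real (n choose k) * ((w k)\<^sup>2 * v ^ k))"
    using sum_Pow_card[of "{1..n}" "\<lambda>k. (w k)\<^sup>2 * v ^ k"] by simp
  finally show ?exp .
qed

lemma level_sum_diff: "level_sum a \<omega> - level_sum b \<omega> = level_sum (\<lambda>k. a k - b k) \<omega>"
  by (simp add: level_sum_def left_diff_distrib sum_subtractf)

text \<open>
  By orthogonality this is a comparison of weights: \<open>(a - b)\<^sup>2 \<le> a\<^sup>2 - b\<^sup>2\<close> for \<open>0 \<le> b \<le> a\<close>. It
  reduces the distance of the two sums to their second moments.
\<close>
lemma level_sum_L2_gap:
  assumes "\<And>k. 0 \<le> b k" "\<And>k. b k \<le> a k" and "0 \<le> v"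
  shows "expectation (\<lambda>\<omega>. (level_sum a \<omega> - level_sum b \<omega>)\<^sup>2)
    \<le> expectation (\<lambda>\<omega>. (level_sum a \<omega>)\<^sup>2) - expectation (\<lambda>\<omega>. (level_sum b \<omega>)\<^sup>2)"
proof -
  have "(a k - b k)\<^sup>2 \<le> (a k)\<^sup>2 - (b k)\<^sup>2" for k
    using mult_left_mono[OF assms(2)[of k] assms(1)[of k]]
    by (simp add: power2_eq_square algebra_simps)
  then have "(\<Sum>k\<le>n. real (n choose k) * ((a k - b k)\<^sup>2 * v ^ k))
      \<le> (\<Sum>k\<le>n. real (n choose k) * (((a k)\<^sup>2 - (b k)\<^sup>2) * v ^ k))"
    using assms(3) by (intro sum_mono mult_left_mono mult_right_mono) auto
  then show ?thesis
    by (simp add: level_sum_diff level_sum_square left_diff_distrib right_diff_distrib sum_subtractf)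
qed

text \<open>
  By the binomial theorem the second moment is \<open>(1 + a\<^sup>2 v) ^ n\<close>.
\<close>
lemma level_sum_power_second_moment_le:
  assumes "0 \<le> v"
  shows "expectation (\<lambda>\<omega>. (level_sum (\<lambda>k. a ^ k) \<omega>)\<^sup>2) \<le> exp (real n * a\<^sup>2 * v)"
proof -
  have "(\<Sum>k\<le>n. real (n choose k) * ((a ^ k)\<^sup>2 * v ^ k)) = (a\<^sup>2 * v + 1) ^ n"
    unfolding binomial_ring
    by (intro sum.cong) (simp_all add: power_mult_distrib power_mult[symmetric] mult.commute)
  also have "\<dots> \<le> exp (a\<^sup>2 * v) ^ n"
    using assms exp_ge_add_one_self[of "a\<^sup>2 * v"] by (intro power_mono) (auto simp: add.commute)
  also have "\<dots> = exp (real n * a\<^sup>2 * v)"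
    by (simp add: exp_of_nat_mult[symmetric] mult.assoc)
  finally show ?thesis by (simp add: level_sum_square)
qed

text \<open>
  Independence reduces the claim to a single factor. On \<open>x \<ge> -1/2\<close> one has
  \<open>1 / (1 + x)\<^sup>2 \<le> 1 - 2x + 8x\<^sup>2\<close>, and for \<open>x = a D\<^sub>i\<close> the linear term has mean zero.
\<close>
lemma inverse_square_product:
  assumes a: "0 \<le> a" "a \<le> 1/2" and ge: "\<And>i \<omega>. i \<in> {1..n} \<Longrightarrow> -1 \<le> D i \<omega>"
  shows "integrable M (\<lambda>\<omega>. 1 / (\<Prod>i\<in>{1..n}. 1 + a * D i \<omega>)\<^sup>2)" (is ?int)
    and "expectation (\<lambda>\<omega>. 1 / (\<Prod>i\<in>{1..n}. 1 + a * D i \<omega>)\<^sup>2) \<le> exp (8 * (real n * a\<^sup>2 * v))"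
      (is ?exp)
proof -
  define g where "g x = 1 / (1 + a * x)\<^sup>2" for x :: real
  have prod_eq: "1 / (\<Prod>i\<in>{1..n}. 1 + a * D i \<omega>)\<^sup>2 = (\<Prod>i\<in>{1..n}. g (D i \<omega>))" for \<omega>
    by (simp add: g_def prod_dividef prod_power_distrib)
  have [measurable]: "g \<in> borel_measurable borel" unfolding g_def[abs_def] by measurable
  have ind: "indep_vars (\<lambda>_. borel) (\<lambda>i \<omega>. g (D i \<omega>)) {1..n}"
    by (rule indep_vars_compose2[OF indep]) simp
  have lower: "1/2 \<le> 1 + a * D i \<omega>" if "i \<in> {1..n}" for i \<omega>
    using mult_left_mono[OF ge[OF that, of \<omega>] a(1)] a by simp
  have bound: "g (D i \<omega>) \<le> 1 - 2 * (a * D i \<omega>) + 8 * (a * D i \<omega>)\<^sup>2" if i: "i \<in> {1..n}" for i \<omega>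
  proof -
    define y where "y = 1 + a * D i \<omega>"
    have y: "y \<ge> 1/2" using lower[OF i, of \<omega>] by (simp add: y_def)
    \<comment> \<open>This product is \<open>(1 - 2 (y - 1) + 8 (y - 1)\<^sup>2) y\<^sup>2 - 1\<close>, and \<open>y \<ge> 1/2\<close> makes it nonnegative.\<close>
    have "0 \<le> (y - 1)\<^sup>2 * ((2 * y - 1) * (4 * y + 1))"
      using y by (intro mult_nonneg_nonneg) auto
    then have "1 \<le> (1 - 2 * (y - 1) + 8 * (y - 1)\<^sup>2) * y\<^sup>2"
      by (simp add: power2_eq_square algebra_simps)
    with y have "1 / y\<^sup>2 \<le> 1 - 2 * (y - 1) + 8 * (y - 1)\<^sup>2"
      by (simp add: divide_le_eq)
    then show ?thesis by (simp add: g_def y_def)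
  qed
  have nonneg: "0 \<le> g x" for x by (simp add: g_def)
  have int_bound: "integrable M (\<lambda>\<omega>. 1 - 2 * (a * D i \<omega>) + 8 * (a * D i \<omega>)\<^sup>2)"
    if "i \<in> {1..n}" for i
    using D_integrable[OF that] square_integrable[OF that] by (simp add: power_mult_distrib)
  have int: "integrable M (\<lambda>\<omega>. g (D i \<omega>))" if i: "i \<in> {1..n}" for i
    using int_bound[OF i]
  proof (rule Bochner_Integration.integrable_bound)
    show "(\<lambda>\<omega>. g (D i \<omega>)) \<in> borel_measurable M" using D_measurable[OF i] by measurable
    show "AE \<omega> in M. norm (g (D i \<omega>)) \<le> norm (1 - 2 * (a * D i \<omega>) + 8 * (a * D i \<omega>)\<^sup>2)"
      using bound[OF i] nonneg by (intro AE_I2) (smt (verit) real_norm_def)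
  qed
  show ?int unfolding prod_eq using ind int by (intro indep_vars_integrable) auto
  have "expectation (\<lambda>\<omega>. 1 / (\<Prod>i\<in>{1..n}. 1 + a * D i \<omega>)\<^sup>2)
      = (\<Prod>i\<in>{1..n}. expectation (\<lambda>\<omega>. g (D i \<omega>)))"
    unfolding prod_eq using ind int by (intro indep_vars_lebesgue_integral) auto
  also have "\<dots> \<le> (\<Prod>i\<in>{1..n}. exp (8 * a\<^sup>2 * v))"
  proof (rule prod_mono, safe)
    fix i assume i: "i \<in> {1..n}"
    show "0 \<le> expectation (\<lambda>\<omega>. g (D i \<omega>))" using nonneg by simp
    have "expectation (\<lambda>\<omega>. g (D i \<omega>))
        \<le> expectation (\<lambda>\<omega>. 1 - 2 * (a * D i \<omega>) + 8 * (a * D i \<omega>)\<^sup>2)"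
      using int[OF i] int_bound[OF i] bound[OF i] by (rule integral_mono)
    also have "\<dots> = 1 + 8 * a\<^sup>2 * v"
      using i D_integrable[OF i] square_integrable[OF i]
      by (simp add: power_mult_distrib mean_zero second_moment prob_space)
    also have "\<dots> \<le> exp (8 * a\<^sup>2 * v)" by (rule exp_ge_add_one_self)
    finally show "expectation (\<lambda>\<omega>. g (D i \<omega>)) \<le> exp (8 * a\<^sup>2 * v)" .
  qed
  also have "\<dots> = exp (8 * (real n * a\<^sup>2 * v))"
    by (simp add: exp_of_nat_mult[symmetric] mult_ac)
  finally show ?exp .
qed

end

section \<open>Characteristic functions of products near one\<close>

text \<open>
  Compare \<open>\<phi>\<^sub>n\<close> with \<open>w\<^sub>n = exp (z / n)\<close>. Both have norm at most 1, so their \<open>n\<close>-th powers differ by at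
  most \<open>n\<close> times their difference, and \<open>n (w\<^sub>n - 1)\<close> has the limit \<open>z\<close> as well.
\<close>
lemma power_tendsto_exp_complex:
  fixes \<phi> :: "nat \<Rightarrow> complex"
  assumes norm: "\<And>n. norm (\<phi> n) \<le> 1"
    and lim: "(\<lambda>n. of_nat n * (\<phi> n - 1)) \<longlonglongrightarrow> z" and z: "Re z \<le> 0"
  shows "(\<lambda>n. \<phi> n ^ n) \<longlonglongrightarrow> exp z"
proof -
  define w where "w n = exp (z * of_real (1 / real n))" for n
  have w_norm: "norm (w n) \<le> 1" for n
    using z by (simp add: w_def divide_nonpos_nonneg)
  have w_power: "\<forall>\<^sub>F n in sequentially. w n ^ n = exp z"
    using eventually_gt_at_top[of 0]
    by eventually_elim (simp add: w_def exp_of_nat_mult[symmetric])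
  have "((\<lambda>h. (exp (z * h) - 1) / h) \<longlongrightarrow> z) (at 0)"
  proof -
    have "((\<lambda>h. exp (z * h)) has_field_derivative z) (at 0)"
      by (auto intro!: derivative_eq_intros)
    then show ?thesis by (simp add: DERIV_def)
  qed
  moreover have "filterlim (\<lambda>n. of_real (1 / real n) :: complex) (at 0) sequentially"
    unfolding filterlim_at
  proof
    show "(\<lambda>n. complex_of_real (1 / real n)) \<longlonglongrightarrow> 0"
      using tendsto_of_real[OF lim_1_over_n, where 'a = complex] by simp
    show "\<forall>\<^sub>F n in sequentially. complex_of_real (1 / real n) \<in> UNIV \<and> complex_of_real (1 / real n) \<noteq> 0"
      using eventually_gt_at_top[of 0] by eventually_elim simp
  qed
  ultimately have "(\<lambda>n. (w n - 1) / of_real (1 / real n)) \<longlonglongrightarrow> z"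
    unfolding w_def by (rule filterlim_compose)
  then have w_lim: "(\<lambda>n. of_nat n * (w n - 1)) \<longlonglongrightarrow> z"
    by (simp add: mult.commute)
  have "(\<lambda>n. norm (of_nat n * (\<phi> n - 1) - of_nat n * (w n - 1))) \<longlonglongrightarrow> norm (z - z)"
    by (intro tendsto_intros lim w_lim)
  then have "(\<lambda>n. norm (of_nat n * (\<phi> n - 1) - of_nat n * (w n - 1))) \<longlonglongrightarrow> 0" by simp
  then have "(\<lambda>n. \<phi> n ^ n - w n ^ n) \<longlonglongrightarrow> 0"
  proof (rule Lim_null_comparison[rotated], intro always_eventually allI)
    fix n
    have "norm (\<phi> n ^ n - w n ^ n) \<le> real n * norm (\<phi> n - w n)"
      by (rule norm_power_diff[OF norm w_norm])
    also have "\<dots> = norm (of_nat n * (\<phi> n - w n))" by (simp add: norm_mult)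
    also have "\<dots> = norm (of_nat n * (\<phi> n - 1) - of_nat n * (w n - 1))"
      by (simp add: algebra_simps)
    finally show "norm (\<phi> n ^ n - w n ^ n) \<le> norm (of_nat n * (\<phi> n - 1) - of_nat n * (w n - 1))" .
  qed
  moreover have "(\<lambda>n. w n ^ n) \<longlonglongrightarrow> exp z"
    using w_power by (rule tendsto_eventually)
  ultimately have "(\<lambda>n. (\<phi> n ^ n - w n ^ n) + w n ^ n) \<longlonglongrightarrow> 0 + exp z"
    by (rule tendsto_add)
  then show ?thesis by simp
qed

lemma abs_ln_one_plus_minus_le:
  fixes x :: real
  assumes "-1/2 \<le> x"
  shows "\<bar>ln (1 + x) - x\<bar> \<le> 2 * x\<^sup>2"
proof (cases "x \<le> 1/2")
  case True
  then show ?thesis using assms by (intro abs_ln_one_plus_x_minus_x_bound) auto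
next
  case False
  then have "0 \<le> ln (1 + x)" "ln (1 + x) \<le> x" "1 * x \<le> (2 * x) * x"
    by (auto intro: ln_add_one_self_le_self mult_right_mono)
  then show ?thesis by (simp add: power2_eq_square)
qed

lemma abs_ln_one_plus_le:
  fixes x :: real
  assumes "-1/2 \<le> x"
  shows "\<bar>ln (1 + x)\<bar> \<le> 2 * \<bar>x\<bar>"
proof (cases "x \<ge> 0")
  case True
  then show ?thesis using ln_add_one_self_le_self[of x] by simp
next
  case False
  then have "2 * x\<^sup>2 \<le> \<bar>x\<bar>"
    using assms mult_right_mono[of "-x" "1/2" "-x"] by (simp add: power2_eq_square)
  then show ?thesis using abs_ln_one_plus_minus_le[OF assms] by linarith
qed

text \<open>
  With \<open>y = t ln (1 + x)\<close>, the remainder splits into \<open>exp (\<i>y) - 1 - \<i>y\<close>, of order \<open>y\<^sup>2\<close>, and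
  \<open>\<i>t (ln (1 + x) - x)\<close>. The bound holds on an unbounded range of \<open>x\<close>, as dominated convergence
  requires.
\<close>
lemma iexp_ln_one_plus_bound:
  fixes x t :: real
  assumes x: "-1/2 \<le> x"
  shows "norm (iexp (t * ln (1 + x)) - 1 - \<i> * (t * x)) \<le> (2 * t\<^sup>2 + 2 * \<bar>t\<bar>) * x\<^sup>2"
proof -
  define y where "y = t * ln (1 + x)"
  have "norm (iexp y - 1 - \<i> * y) \<le> y\<^sup>2 / 2"
    using iexp_approx1[of y 1] by (simp add: algebra_simps power2_eq_square)
  also have "\<dots> \<le> 2 * t\<^sup>2 * x\<^sup>2"
  proof -
    have "(ln (1 + x))\<^sup>2 \<le> (2 * x)\<^sup>2"
      using power_mono[OF abs_ln_one_plus_le[OF x] abs_ge_zero, of 2] by (simp add: power_mult_distrib)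
    then have "t\<^sup>2 * (ln (1 + x))\<^sup>2 \<le> t\<^sup>2 * (2 * x)\<^sup>2" by (intro mult_left_mono) auto
    then show ?thesis by (simp add: y_def power_mult_distrib)
  qed
  finally have 1: "norm (iexp y - 1 - \<i> * y) \<le> 2 * t\<^sup>2 * x\<^sup>2" .
  have "norm (\<i> * y - \<i> * (t * x)) = \<bar>t\<bar> * \<bar>ln (1 + x) - x\<bar>"
  proof -
    have "\<i> * y - \<i> * (t * x) = \<i> * of_real (t * (ln (1 + x) - x))"
      by (simp add: y_def algebra_simps)
    then show ?thesis by (simp only: norm_mult norm_of_real norm_ii abs_mult)
  qed
  also have "\<dots> \<le> \<bar>t\<bar> * (2 * x\<^sup>2)"
    using abs_ln_one_plus_minus_le[OF x] by (rule mult_left_mono) simp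
  finally have 2: "norm (\<i> * y - \<i> * (t * x)) \<le> 2 * \<bar>t\<bar> * x\<^sup>2" by simp
  have "norm ((iexp y - 1 - \<i> * y) + (\<i> * y - \<i> * (t * x))) \<le> 2 * t\<^sup>2 * x\<^sup>2 + 2 * \<bar>t\<bar> * x\<^sup>2"
    using 1 2 by (rule norm_triangle_mono)
  then show ?thesis by (simp add: y_def algebra_simps)
qed

lemma iexp_ln_one_plus_limit:
  fixes t :: real
  shows "((\<lambda>x::real. (iexp (t * ln (1 + x)) - 1 - \<i> * (t * x)) / x\<^sup>2)
    \<longlongrightarrow> - (t\<^sup>2 + \<i> * t) / 2) (at 0)"
proof -
  have Re: "((\<lambda>x::real. (cos (t * ln (1 + x)) - 1) / x\<^sup>2) \<longlongrightarrow> - t\<^sup>2 / 2) (at 0)"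
    by (cases "t = 0") (simp, real_asymp simp: power2_eq_square)
  have Im: "((\<lambda>x::real. (sin (t * ln (1 + x)) - t * x) / x\<^sup>2) \<longlongrightarrow> - t / 2) (at 0)"
    by (cases "t = 0") (simp, real_asymp)
  have "((\<lambda>x::real. Complex ((cos (t * ln (1 + x)) - 1) / x\<^sup>2) ((sin (t * ln (1 + x)) - t * x) / x\<^sup>2))
      \<longlongrightarrow> Complex (- t\<^sup>2 / 2) (- t / 2)) (at 0)"
    by (intro tendsto_Complex Re Im)
  moreover have "Complex ((cos (t * ln (1 + x)) - 1) / x\<^sup>2) ((sin (t * ln (1 + x)) - t * x) / x\<^sup>2)
      = (iexp (t * ln (1 + x)) - 1 - \<i> * (t * x)) / x\<^sup>2" for x :: real
    by (simp add: complex_eq_iff Re_exp Im_exp Re_divide_of_real Im_divide_of_real flip: of_real_power)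
  moreover have "Complex (- t\<^sup>2 / 2) (- t / 2) = - (t\<^sup>2 + \<i> * t) / 2"
    by (simp add: complex_eq_iff flip: of_real_power)
  ultimately show ?thesis by (simp only:)
qed

text \<open>
  Since \<open>\<Delta>\<close> is centred, \<open>\<phi> - 1\<close> is the expectation of the second order remainder \<open>e (a\<^sub>n \<Delta>)\<close>. Multiplied
  by \<open>n\<close>, the remainder converges pointwise to \<open>- \<lambda> (t\<^sup>2 + \<i>t) \<Delta>\<^sup>2 / 2\<close> and is dominated by a multiple
  of \<open>\<Delta>\<^sup>2\<close>, because \<open>n a\<^sub>n\<^sup>2\<close> is bounded. The bound \<open>a\<^sub>n \<le> 1/2\<close> keeps \<open>a\<^sub>n \<Delta>\<close> above \<open>- 1/2\<close>.
\<close>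
lemma (in prob_space) log_increment_char_limit:
  fixes \<Delta> :: "'a \<Rightarrow> real" and a :: "nat \<Rightarrow> real" and t lam v :: real
  assumes [measurable]: "\<Delta> \<in> borel_measurable M"
    and sq: "integrable M (\<lambda>x. (\<Delta> x)\<^sup>2)" and mean: "expectation \<Delta> = 0"
    and var: "expectation (\<lambda>x. (\<Delta> x)\<^sup>2) = v" and ge: "\<And>x. -1 \<le> \<Delta> x"
    and a: "\<And>n. 0 \<le> a n" "\<And>n. a n \<le> 1/2" "a \<longlonglongrightarrow> 0"
    and lim: "(\<lambda>n. real n * (a n)\<^sup>2) \<longlonglongrightarrow> lam"
  shows "(\<lambda>n. of_nat n * (char (distr M borel (\<lambda>x. ln (1 + a n * \<Delta> x))) t - 1))
    \<longlonglongrightarrow> - (lam * v) * (t\<^sup>2 + \<i> * t) / 2"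
proof -
  define e where "e x = iexp (t * ln (1 + x)) - 1 - \<i> * (t * x)" for x :: real
  have [measurable]: "e \<in> borel_measurable borel" unfolding e_def[abs_def] by measurable
  have int: "integrable M \<Delta>"
    by (rule square_integrable_imp_integrable) fact+
  have lower: "-1/2 \<le> a n * \<Delta> x" for n x
    using mult_left_mono[OF ge[of x] a(1)[of n]] a(2)[of n] by simp
  have e_bound: "norm (e (a n * \<Delta> x)) \<le> (2 * t\<^sup>2 + 2 * \<bar>t\<bar>) * (a n * \<Delta> x)\<^sup>2" for n x
    unfolding e_def by (rule iexp_ln_one_plus_bound[OF lower])
  have e_int: "integrable M (\<lambda>x. e (a n * \<Delta> x))" for n
  proof (rule Bochner_Integration.integrable_bound)
    show "integrable M (\<lambda>x. (2 * t\<^sup>2 + 2 * \<bar>t\<bar>) * (a n * \<Delta> x)\<^sup>2)"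
      using sq by (simp add: power_mult_distrib)
    show "AE x in M. norm (e (a n * \<Delta> x)) \<le> norm ((2 * t\<^sup>2 + 2 * \<bar>t\<bar>) * (a n * \<Delta> x)\<^sup>2)"
      using e_bound by (intro AE_I2) (smt (verit) real_norm_def)
  qed measurable
  have char_eq: "char (distr M borel (\<lambda>x. ln (1 + a n * \<Delta> x))) t - 1
      = (CLINT x|M. e (a n * \<Delta> x))" for n
  proof -
    have "(CLINT x|M. e (a n * \<Delta> x) + (1 + \<i> * (t * (a n * \<Delta> x))))
        = (CLINT x|M. e (a n * \<Delta> x)) + (CLINT x|M. 1 + \<i> * (t * (a n * \<Delta> x)))"
      using int by (intro Bochner_Integration.integral_add e_int) auto
    also have "(CLINT x|M. 1 + \<i> * (t * (a n * \<Delta> x)))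
        = 1 + \<i> * (t * (a n * expectation \<Delta>))"
      using int by (subst Bochner_Integration.integral_add) (auto simp: prob_space)
    finally have "(CLINT x|M. iexp (t * ln (1 + a n * \<Delta> x))) = (CLINT x|M. e (a n * \<Delta> x)) + 1"
      by (simp add: mean e_def)
    then show ?thesis by (simp add: char_def integral_distr)
  qed
  have Bseq: "Bseq (\<lambda>n. real n * (a n)\<^sup>2)"
    using lim by (intro convergent_imp_Bseq convergentI)
  then obtain K where K: "\<And>n. norm (real n * (a n)\<^sup>2) \<le> K" by (elim BseqE) blast
  have "(\<lambda>n. CLINT x|M. of_nat n * e (a n * \<Delta> x))
      \<longlonglongrightarrow> (CLINT x|M. - (t\<^sup>2 + \<i> * t) / 2 * lam * (\<Delta> x)\<^sup>2)"
  proof (rule integral_dominated_convergence[where w = "\<lambda>x. (2 * t\<^sup>2 + 2 * \<bar>t\<bar>) * K * (\<Delta> x)\<^sup>2"])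
    show "integrable M (\<lambda>x. (2 * t\<^sup>2 + 2 * \<bar>t\<bar>) * K * (\<Delta> x)\<^sup>2)" using sq by simp
    show "AE x in M. norm (of_nat n * e (a n * \<Delta> x)) \<le> (2 * t\<^sup>2 + 2 * \<bar>t\<bar>) * K * (\<Delta> x)\<^sup>2" for n
    proof (intro AE_I2)
      fix x
      have "norm (of_nat n * e (a n * \<Delta> x)) \<le> real n * ((2 * t\<^sup>2 + 2 * \<bar>t\<bar>) * (a n * \<Delta> x)\<^sup>2)"
        using e_bound by (simp add: norm_mult mult_left_mono)
      also have "\<dots> = (2 * t\<^sup>2 + 2 * \<bar>t\<bar>) * (real n * (a n)\<^sup>2) * (\<Delta> x)\<^sup>2"
        by (simp add: power_mult_distrib)
      also have "\<dots> \<le> (2 * t\<^sup>2 + 2 * \<bar>t\<bar>) * K * (\<Delta> x)\<^sup>2"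
        using K[of n] by (intro mult_right_mono mult_left_mono) auto
      finally show "norm (of_nat n * e (a n * \<Delta> x)) \<le> (2 * t\<^sup>2 + 2 * \<bar>t\<bar>) * K * (\<Delta> x)\<^sup>2" .
    qed
    show "AE x in M. (\<lambda>n. of_nat n * e (a n * \<Delta> x))
        \<longlonglongrightarrow> - (t\<^sup>2 + \<i> * t) / 2 * lam * (\<Delta> x)\<^sup>2"
    proof (intro AE_I2)
      fix x
      \<comment> \<open>The quotient \<open>e y / y\<^sup>2\<close> is extended continuously to \<open>y = 0\<close>, so that points with \<open>\<Delta> x = 0\<close> need no special care.\<close>
      define q where "q y = (if y = 0 then - (t\<^sup>2 + \<i> * t) / 2 else e y / y\<^sup>2)" for y :: real
      have e_q: "e y = q y * (of_real y)\<^sup>2" for y by (simp add: q_def e_def)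
      have "(q \<longlongrightarrow> - (t\<^sup>2 + \<i> * t) / 2) (at 0)"
        using iexp_ln_one_plus_limit[of t]
        by (rule Lim_transform_eventually) (auto simp: q_def e_def eventually_at_filter)
      then have "isCont q 0" by (simp add: isCont_def q_def)
      moreover have "(\<lambda>n. a n * \<Delta> x) \<longlonglongrightarrow> 0"
        using tendsto_mult_right[OF a(3), of "\<Delta> x"] by simp
      ultimately have "(\<lambda>n. q (a n * \<Delta> x)) \<longlonglongrightarrow> q 0"
        by (rule isCont_tendsto_compose)
      then have "(\<lambda>n. q (a n * \<Delta> x) * of_real (real n * (a n)\<^sup>2) * (\<Delta> x)\<^sup>2)
          \<longlonglongrightarrow> q 0 * lam * (\<Delta> x)\<^sup>2"
        by (intro tendsto_intros lim)
      then show "(\<lambda>n. of_nat n * e (a n * \<Delta> x))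
          \<longlonglongrightarrow> - (t\<^sup>2 + \<i> * t) / 2 * lam * (\<Delta> x)\<^sup>2"
        by (simp add: e_q q_def[of 0] power_mult_distrib mult_ac)
    qed
  qed measurable
  moreover have "(CLINT x|M. - (t\<^sup>2 + \<i> * t) / 2 * lam * (\<Delta> x)\<^sup>2)
      = - (lam * v) * (t\<^sup>2 + \<i> * t) / 2"
    using sq var by (simp add: algebra_simps flip: of_real_power)
  ultimately show ?thesis by (simp add: char_eq)
qed

section \<open>Weak convergence and comparison of random variables\<close>

lemma weak_conv_m_eventually_cong:
  assumes "\<forall>\<^sub>F n in sequentially. \<mu> n = \<mu>' n" "weak_conv_m \<mu> \<nu>"
  shows "weak_conv_m \<mu>' \<nu>"
  unfolding weak_conv_m_def weak_conv_def
proof (intro allI impI)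
  fix x assume "isCont (cdf \<nu>) x"
  then have "(\<lambda>n. cdf (\<mu> n) x) \<longlonglongrightarrow> cdf \<nu> x"
    using assms(2) by (auto simp: weak_conv_m_def weak_conv_def)
  moreover have "\<forall>\<^sub>F n in sequentially. cdf (\<mu> n) x = cdf (\<mu>' n) x"
    using assms(1) by eventually_elim simp
  ultimately show "(\<lambda>n. cdf (\<mu>' n) x) \<longlonglongrightarrow> cdf \<nu> x"
    by (rule Lim_transform_eventually)
qed

text \<open>
  The members of the sequence need to be probability laws only from some index on; before that they
  are replaced by the limit law. The same device gives the next lemma.
\<close>
lemma weak_conv_m_imp_integral_tendsto:
  fixes f :: "real \<Rightarrow> complex"
  assumes ev: "\<forall>\<^sub>F n in sequentially. real_distribution (\<mu> n)" and \<nu>: "real_distribution \<nu>"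
    and conv: "weak_conv_m \<mu> \<nu>"
    and f: "\<And>x. isCont f x" "\<And>x. norm (f x) \<le> B"
  shows "(\<lambda>n. integral\<^sup>L (\<mu> n) f) \<longlonglongrightarrow> integral\<^sup>L \<nu> f"
proof -
  define \<mu>' where "\<mu>' n = (if real_distribution (\<mu> n) then \<mu> n else \<nu>)" for n
  have eq: "\<forall>\<^sub>F n in sequentially. \<mu> n = \<mu>' n"
    using ev by eventually_elim (simp add: \<mu>'_def)
  have "real_distribution (\<mu>' n)" for n using \<nu> by (simp add: \<mu>'_def)
  then have "(\<lambda>n. integral\<^sup>L (\<mu>' n) f) \<longlonglongrightarrow> integral\<^sup>L \<nu> f"
    using \<nu> weak_conv_m_eventually_cong[OF eq conv] f
    by (rule weak_conv_imp_integral_bdd_continuous_conv)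
  then show ?thesis
    by (rule Lim_transform_eventually) (use eq in eventually_elim, simp)
qed

lemma levy_continuity_eventually:
  assumes ev: "\<forall>\<^sub>F n in sequentially. real_distribution (\<mu> n)" and \<nu>: "real_distribution \<nu>"
    and lim: "\<And>t. (\<lambda>n. char (\<mu> n) t) \<longlonglongrightarrow> char \<nu> t"
  shows "weak_conv_m \<mu> \<nu>"
proof -
  define \<mu>' where "\<mu>' n = (if real_distribution (\<mu> n) then \<mu> n else \<nu>)" for n
  have eq: "\<forall>\<^sub>F n in sequentially. \<mu>' n = \<mu> n"
    using ev by eventually_elim (simp add: \<mu>'_def)
  have "(\<lambda>n. char (\<mu>' n) t) \<longlonglongrightarrow> char \<nu> t" for t
    using lim by (rule Lim_transform_eventually) (use eq in eventually_elim, simp)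
  then have "weak_conv_m \<mu>' \<nu>"
    using \<nu> by (intro levy_continuity) (simp_all add: \<mu>'_def)
  with eq show ?thesis by (rule weak_conv_m_eventually_cong)
qed

text \<open>
  The map \<open>x \<mapsto> exp (\<i>x)\<close> is 1-Lipschitz. Through this bound a perturbation that is small in mean leaves
  the limit law unchanged.
\<close>
lemma (in prob_space) char_diff_le:
  assumes [measurable]: "random_variable borel X" "random_variable borel Y"
    and int: "integrable M (\<lambda>x. \<bar>X x - Y x\<bar>)"
  shows "norm (char (distr M borel X) t - char (distr M borel Y) t)
    \<le> \<bar>t\<bar> * expectation (\<lambda>x. \<bar>X x - Y x\<bar>)"
proof -
  have iexp_diff: "norm (iexp a - iexp b) \<le> \<bar>a - b\<bar>" for a b
  proof -
    have "iexp a - iexp b = iexp b * (iexp (a - b) - 1)"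
      by (simp add: right_diff_distrib flip: exp_add distrib_left of_real_add)
    then have "norm (iexp a - iexp b) = norm (iexp (a - b) - 1)" by (simp add: norm_mult)
    then show ?thesis using iexp_approx1[of "a - b" 0] by simp
  qed
  have int_iexp: "integrable M (\<lambda>x. iexp (t * f x))" if [measurable]: "random_variable borel f" for f
    by (rule integrable_const_bound[of _ 1]) auto
  have "char (distr M borel X) t - char (distr M borel Y) t
      = (CLINT x|M. iexp (t * X x) - iexp (t * Y x))"
  proof -
    have "(CLINT x|M. iexp (t * X x) - iexp (t * Y x))
        = (CLINT x|M. iexp (t * X x)) - (CLINT x|M. iexp (t * Y x))"
      by (intro Bochner_Integration.integral_diff int_iexp) fact+
    then show ?thesis by (simp add: char_def integral_distr)
  qed
  also have "norm \<dots> \<le> expectation (\<lambda>x. norm (iexp (t * X x) - iexp (t * Y x)))"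
    by (rule integral_norm_bound)
  also have "\<dots> \<le> expectation (\<lambda>x. \<bar>t\<bar> * \<bar>X x - Y x\<bar>)"
  proof (rule integral_mono)
    show "integrable M (\<lambda>x. norm (iexp (t * X x) - iexp (t * Y x)))"
      by (intro integrable_norm Bochner_Integration.integrable_diff int_iexp) fact+
    show "integrable M (\<lambda>x. \<bar>t\<bar> * \<bar>X x - Y x\<bar>)" using int by simp
    show "norm (iexp (t * X x) - iexp (t * Y x)) \<le> \<bar>t\<bar> * \<bar>X x - Y x\<bar>" for x
      using iexp_diff[of "t * X x" "t * Y x"] by (simp add: right_diff_distrib flip: abs_mult)
  qed
  finally show ?thesis by simp
qed

text \<open>
  The variance of \<open>\<bar>X\<bar>\<close> is nonnegative.
\<close>
lemma (in prob_space) expectation_abs_le_sqrt: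
  fixes X :: "'a \<Rightarrow> real"
  assumes "random_variable borel X" "integrable M (\<lambda>x. (X x)\<^sup>2)"
  shows "expectation (\<lambda>x. \<bar>X x\<bar>) \<le> sqrt (expectation (\<lambda>x. (X x)\<^sup>2))"
proof (rule real_le_rsqrt)
  have "integrable M X" using assms by (rule square_integrable_imp_integrable)
  then have "variance (\<lambda>x. \<bar>X x\<bar>) = expectation (\<lambda>x. (X x)\<^sup>2) - (expectation (\<lambda>x. \<bar>X x\<bar>))\<^sup>2"
    using assms(2) by (subst variance_eq) simp_all
  then show "(expectation (\<lambda>x. \<bar>X x\<bar>))\<^sup>2 \<le> expectation (\<lambda>x. (X x)\<^sup>2)"
    using variance_positive[of "\<lambda>x. \<bar>X x\<bar>"] by linarith
qed

text \<open>
  Write \<open>X / Y - 1 = (X - Y) / Y\<close>, bound the product by the arithmetic-geometric mean inequality with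
  a free parameter \<open>\<eta>\<close>, and apply Markov's inequality. If \<open>E (X - Y)\<^sup>2\<close> is small and \<open>E Y\<^sup>-\<^sup>2\<close> is bounded,
  a suitable \<open>\<eta>\<close> makes the right side small.
\<close>
lemma (in prob_space) ratio_deviation_bound:
  fixes X Y :: "'a \<Rightarrow> real"
  assumes [measurable]: "random_variable borel X" "random_variable borel Y"
    and Y: "\<And>\<omega>. Y \<omega> \<noteq> 0"
    and int: "integrable M (\<lambda>\<omega>. (X \<omega> - Y \<omega>)\<^sup>2)" "integrable M (\<lambda>\<omega>. 1 / (Y \<omega>)\<^sup>2)"
    and pos: "0 < \<eta>" "0 < \<epsilon>"
  shows "prob {\<omega> \<in> space M. \<bar>X \<omega> / Y \<omega> - 1\<bar> > \<epsilon>}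
    \<le> (expectation (\<lambda>\<omega>. (X \<omega> - Y \<omega>)\<^sup>2) / \<eta> + \<eta> * expectation (\<lambda>\<omega>. 1 / (Y \<omega>)\<^sup>2)) / (2 * \<epsilon>)"
proof -
  define U where "U \<omega> = ((X \<omega> - Y \<omega>)\<^sup>2 / \<eta> + \<eta> * (1 / (Y \<omega>)\<^sup>2)) / 2" for \<omega>
  have U_int: "integrable M U" unfolding U_def[abs_def]
    by (intro integrable_divide_zero Bochner_Integration.integrable_add integrable_mult_right int)
  have U_nonneg: "0 \<le> U \<omega>" for \<omega> using pos by (simp add: U_def)
  have dev: "\<bar>X \<omega> / Y \<omega> - 1\<bar> \<le> U \<omega>" for \<omega>
  proof -
    define b where "b = \<bar>X \<omega> - Y \<omega>\<bar>"
    define c where "c = 1 / \<bar>Y \<omega>\<bar>"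
    have "0 \<le> (b / sqrt \<eta> - sqrt \<eta> * c)\<^sup>2" by simp
    also have "\<dots> = b\<^sup>2 / \<eta> - 2 * (b * c) + \<eta> * c\<^sup>2"
      using pos by (simp add: power2_diff power_divide power_mult_distrib)
    finally have "b * c \<le> (b\<^sup>2 / \<eta> + \<eta> * c\<^sup>2) / 2" by simp
    moreover have "\<bar>X \<omega> / Y \<omega> - 1\<bar> = b * c"
    proof -
      have "X \<omega> / Y \<omega> - 1 = (X \<omega> - Y \<omega>) / Y \<omega>" using Y by (simp add: field_simps)
      then show ?thesis by (simp add: b_def c_def)
    qed
    ultimately show ?thesis by (simp add: U_def b_def c_def power_divide)
  qed
  have "prob {\<omega> \<in> space M. \<bar>X \<omega> / Y \<omega> - 1\<bar> > \<epsilon>} \<le> prob {\<omega> \<in> space M. U \<omega> \<ge> \<epsilon>}"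
    using dev U_int by (intro finite_measure_mono) (auto intro: order_trans[OF less_imp_le])
  also have "\<dots> \<le> expectation U / \<epsilon>"
    using U_int U_nonneg pos by (intro integral_Markov_inequality_measure[where A = "{}"]) auto
  also have "expectation U = (expectation (\<lambda>\<omega>. (X \<omega> - Y \<omega>)\<^sup>2) / \<eta>
      + \<eta> * expectation (\<lambda>\<omega>. 1 / (Y \<omega>)\<^sup>2)) / 2"
    unfolding U_def[abs_def] integral_divide_zero
    by (subst Bochner_Integration.integral_add)
       (simp_all only: integral_divide_zero integral_mult_right_zero int integrable_divide_zero integrable_mult_right)
  finally show ?thesis by simp
qed

section \<open>Convergence in Wasserstein distance\<close>

lemma wasserstein2_le_coupling:
  fixes X Y :: "'a \<Rightarrow> real"
  assumes "prob_space \<Omega>" and [measurable]: "X \<in> borel_measurable \<Omega>" "Y \<in> borel_measurable \<Omega>"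
    and int: "integrable \<Omega> (\<lambda>x. (X x - Y x)\<^sup>2)"
  shows "wasserstein2 (distr \<Omega> borel X) (distr \<Omega> borel Y)
    \<le> ennreal (sqrt (integral\<^sup>L \<Omega> (\<lambda>x. (X x - Y x)\<^sup>2)))"
proof -
  interpret prob_space \<Omega> by fact
  define \<gamma> where "\<gamma> = distr \<Omega> (borel \<Otimes>\<^sub>M borel) (\<lambda>x. (X x, Y x))"
  have "\<gamma> \<in> couplings (distr \<Omega> borel X) (distr \<Omega> borel Y)"
    unfolding couplings_def \<gamma>_def
    by (auto simp: distr_distr comp_def intro!: prob_space_distr)
  then have "(INF \<gamma>\<in>couplings (distr \<Omega> borel X) (distr \<Omega> borel Y).
      \<integral>\<^sup>+ z. ennreal ((fst z - snd z)\<^sup>2) \<partial>\<gamma>) \<le> (\<integral>\<^sup>+ z. ennreal ((fst z - snd z)\<^sup>2) \<partial>\<gamma>)"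
    by (rule INF_lower)
  also have "\<dots> = (\<integral>\<^sup>+ x. ennreal ((X x - Y x)\<^sup>2) \<partial>\<Omega>)"
    unfolding \<gamma>_def by (subst nn_integral_distr) auto
  also have "\<dots> = ennreal (integral\<^sup>L \<Omega> (\<lambda>x. (X x - Y x)\<^sup>2))"
    using int by (rule nn_integral_eq_integral) simp
  finally have cost: "(INF \<gamma>\<in>couplings (distr \<Omega> borel X) (distr \<Omega> borel Y).
      \<integral>\<^sup>+ z. ennreal ((fst z - snd z)\<^sup>2) \<partial>\<gamma>) \<le> ennreal (integral\<^sup>L \<Omega> (\<lambda>x. (X x - Y x)\<^sup>2))"
    (is "?cost \<le> _") .
  also have "\<dots> < \<infinity>" by simp
  finally have "?cost \<noteq> \<infinity>" by (rule less_imp_neq)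
  moreover have "enn2real ?cost \<le> integral\<^sup>L \<Omega> (\<lambda>x. (X x - Y x)\<^sup>2)"
    using cost by (intro enn2real_leI) auto
  ultimately show ?thesis
    by (simp only: wasserstein2_def Let_def if_False) (intro ennreal_leI real_sqrt_le_mono)
qed

text \<open>
  By the parallelogram identity \<open>2 Y\<^sub>n\<^sup>2 + 2 Y'\<^sup>2 - (Y\<^sub>n - Y')\<^sup>2\<close> is nonnegative, and it converges
  pointwise to \<open>4 Y'\<^sup>2\<close>. Fatou's lemma and the convergence of the second moments then force
  \<open>E (Y\<^sub>n - Y')\<^sup>2 \<rightarrow> 0\<close>.
\<close>
lemma L2_convergence_of_norm_convergence:
  fixes Y :: "nat \<Rightarrow> 'a \<Rightarrow> real"
  assumes [measurable]: "\<And>n. Y n \<in> borel_measurable \<Omega>" "Y' \<in> borel_measurable \<Omega>"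
    and int: "\<And>n. integrable \<Omega> (\<lambda>x. (Y n x)\<^sup>2)" "integrable \<Omega> (\<lambda>x. (Y' x)\<^sup>2)"
    and conv: "\<And>x. x \<in> space \<Omega> \<Longrightarrow> (\<lambda>n. Y n x) \<longlonglongrightarrow> Y' x"
    and moments: "(\<lambda>n. integral\<^sup>L \<Omega> (\<lambda>x. (Y n x)\<^sup>2)) \<longlonglongrightarrow> integral\<^sup>L \<Omega> (\<lambda>x. (Y' x)\<^sup>2)"
  shows "\<And>n. integrable \<Omega> (\<lambda>x. (Y n x - Y' x)\<^sup>2)"
    and "(\<lambda>n. integral\<^sup>L \<Omega> (\<lambda>x. (Y n x - Y' x)\<^sup>2)) \<longlonglongrightarrow> 0"
proof -
  have par: "(a - b)\<^sup>2 + (a + b)\<^sup>2 = 2 * a\<^sup>2 + 2 * b\<^sup>2" for a b :: real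
    by (simp add: power2_eq_square algebra_simps)
  have diff_le: "(a - b)\<^sup>2 \<le> 2 * a\<^sup>2 + 2 * b\<^sup>2" for a b :: real
    using par[of a b] by (smt (verit) zero_le_power2)
  show diff_int: "integrable \<Omega> (\<lambda>x. (Y n x - Y' x)\<^sup>2)" for n
  proof (rule Bochner_Integration.integrable_bound)
    show "integrable \<Omega> (\<lambda>x. 2 * (Y n x)\<^sup>2 + 2 * (Y' x)\<^sup>2)" using int by simp
    show "AE x in \<Omega>. norm ((Y n x - Y' x)\<^sup>2) \<le> norm (2 * (Y n x)\<^sup>2 + 2 * (Y' x)\<^sup>2)"
      using diff_le by (intro AE_I2) simp
  qed measurable
  define E where "E n = integral\<^sup>L \<Omega> (\<lambda>x. (Y n x - Y' x)\<^sup>2)" for n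
  define c where "c = integral\<^sup>L \<Omega> (\<lambda>x. (Y' x)\<^sup>2)"
  define h where "h n x = 2 * (Y n x)\<^sup>2 + 2 * (Y' x)\<^sup>2 - (Y n x - Y' x)\<^sup>2" for n x
  have h_int: "integrable \<Omega> (h n)" for n
    unfolding h_def[abs_def] using int diff_int by simp
  have h_nonneg: "0 \<le> h n x" for n x using diff_le by (simp add: h_def)
  have h_integral: "integral\<^sup>L \<Omega> (h n) = 2 * integral\<^sup>L \<Omega> (\<lambda>x. (Y n x)\<^sup>2) + 2 * c - E n" for n
    unfolding h_def[abs_def] using int diff_int by (simp add: E_def c_def)
  have "(\<integral>\<^sup>+x. ennreal (4 * (Y' x)\<^sup>2) \<partial>\<Omega>) = (\<integral>\<^sup>+x. liminf (\<lambda>n. ennreal (h n x)) \<partial>\<Omega>)"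
  proof (rule nn_integral_cong)
    fix x assume x: "x \<in> space \<Omega>"
    have "(\<lambda>n. h n x) \<longlonglongrightarrow> 2 * (Y' x)\<^sup>2 + 2 * (Y' x)\<^sup>2 - (Y' x - Y' x)\<^sup>2"
      unfolding h_def by (intro tendsto_intros conv x)
    then have "(\<lambda>n. ennreal (h n x)) \<longlonglongrightarrow> ennreal (4 * (Y' x)\<^sup>2)"
      by (intro tendsto_ennrealI) simp
    then show "ennreal (4 * (Y' x)\<^sup>2) = liminf (\<lambda>n. ennreal (h n x))"
      by (simp add: lim_imp_Liminf)
  qed
  also have "\<dots> \<le> liminf (\<lambda>n. \<integral>\<^sup>+x. ennreal (h n x) \<partial>\<Omega>)"
    unfolding h_def by (intro nn_integral_liminf) measurable
  also have "(\<integral>\<^sup>+x. ennreal (4 * (Y' x)\<^sup>2) \<partial>\<Omega>) = ennreal (4 * c)"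
    using int by (subst nn_integral_eq_integral) (auto simp: c_def)
  finally have fatou: "ennreal (4 * c) \<le> liminf (\<lambda>n. ennreal (integral\<^sup>L \<Omega> (h n)))"
    using h_int h_nonneg by (simp add: nn_integral_eq_integral)
  have E_nonneg: "0 \<le> E n" for n by (simp add: E_def)
  show "E \<longlonglongrightarrow> 0"
  proof (rule order_tendstoI)
    fix e :: real assume "e < 0"
    then show "\<forall>\<^sub>F n in sequentially. e < E n"
      using E_nonneg by (intro always_eventually allI) (rule less_le_trans)
  next
    fix e :: real assume e: "0 < e"
    have c: "0 \<le> c" by (simp add: c_def)
    have *: "\<forall>\<^sub>F n in sequentially. integral\<^sup>L \<Omega> (\<lambda>x. (Y n x)\<^sup>2) < c + e / 4"
      using moments e by (intro order_tendstoD) (auto simp: c_def)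
    have "\<forall>\<^sub>F n in sequentially. 4 * c - e / 2 < integral\<^sup>L \<Omega> (h n)"
    proof (cases "4 * c - e / 2 < 0")
      case True
      have "0 \<le> integral\<^sup>L \<Omega> (h n)" for n using h_nonneg by simp
      with True show ?thesis by (intro always_eventually allI) (rule less_le_trans)
    next
      case False
      then have "ennreal (4 * c - e / 2) < ennreal (4 * c)" using e by (intro ennreal_lessI) auto
      also note fatou
      finally have "\<forall>\<^sub>F n in sequentially. ennreal (4 * c - e / 2) < ennreal (integral\<^sup>L \<Omega> (h n))"
        by (rule less_LiminfD)
      then show ?thesis by eventually_elim (use False in \<open>simp add: ennreal_less_iff\<close>)
    qed
    with * show "\<forall>\<^sub>F n in sequentially. E n < e"
      by eventually_elim (simp add: h_integral)
  qed
qed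

text \<open>
  Skorohod's representation puts all the laws on one space with pointwise convergence. This is a
  coupling, and its cost tends to 0 because the second moments converge.
\<close>
lemma wasserstein2_tendsto_0:
  assumes \<mu>: "\<And>n. real_distribution (\<mu> n)" and \<nu>: "real_distribution \<nu>"
    and conv: "weak_conv_m \<mu> \<nu>"
    and int: "\<And>n. integrable (\<mu> n) (\<lambda>x. x\<^sup>2)" "integrable \<nu> (\<lambda>x. x\<^sup>2)"
    and moments: "(\<lambda>n. integral\<^sup>L (\<mu> n) (\<lambda>x. x\<^sup>2)) \<longlonglongrightarrow> integral\<^sup>L \<nu> (\<lambda>x. x\<^sup>2)"
  shows "(\<lambda>n. wasserstein2 (\<mu> n) \<nu>) \<longlonglongrightarrow> 0"
proof -
  obtain \<Omega> :: "real measure" and Y Y' where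
    \<Omega>: "prob_space \<Omega>" and Y[measurable]: "\<And>n. Y n \<in> borel_measurable \<Omega>"
    and distr_Y: "\<And>n. distr \<Omega> borel (Y n) = \<mu> n"
    and Y'[measurable]: "Y' \<in> borel_measurable \<Omega>"
    and distr_Y': "distr \<Omega> borel Y' = \<nu>"
    and Y_lim: "\<And>x. x \<in> space \<Omega> \<Longrightarrow> (\<lambda>n. Y n x) \<longlonglongrightarrow> Y' x"
    using Skorohod[OF \<mu> \<nu> conv] by force
  have int_Y: "integrable \<Omega> (\<lambda>x. (Y n x)\<^sup>2)" for n
    using int(1)[of n] unfolding distr_Y[symmetric] by (simp add: integrable_distr_eq)
  have int_Y': "integrable \<Omega> (\<lambda>x. (Y' x)\<^sup>2)"
    using int(2) unfolding distr_Y'[symmetric] by (simp add: integrable_distr_eq)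
  have "(\<lambda>n. integral\<^sup>L \<Omega> (\<lambda>x. (Y n x)\<^sup>2)) \<longlonglongrightarrow> integral\<^sup>L \<Omega> (\<lambda>x. (Y' x)\<^sup>2)"
    using moments unfolding distr_Y[symmetric] distr_Y'[symmetric] by (simp add: integral_distr)
  note L2 = L2_convergence_of_norm_convergence[OF Y Y' int_Y int_Y' Y_lim this]
  have "(\<lambda>n. ennreal (sqrt (integral\<^sup>L \<Omega> (\<lambda>x. (Y n x - Y' x)\<^sup>2)))) \<longlonglongrightarrow> ennreal (sqrt 0)"
    by (intro tendsto_ennrealI tendsto_real_sqrt L2(2))
  then have "(\<lambda>n. ennreal (sqrt (integral\<^sup>L \<Omega> (\<lambda>x. (Y n x - Y' x)\<^sup>2)))) \<longlonglongrightarrow> 0" by simp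
  moreover have "wasserstein2 (\<mu> n) \<nu> \<le> ennreal (sqrt (integral\<^sup>L \<Omega> (\<lambda>x. (Y n x - Y' x)\<^sup>2)))" for n
    using wasserstein2_le_coupling[OF \<Omega> Y Y' L2(1), of n] by (simp add: distr_Y distr_Y')
  ultimately show ?thesis
    by - (rule tendsto_sandwich[where f = "\<lambda>_. 0" and h = "\<lambda>n. ennreal (sqrt (integral\<^sup>L \<Omega> (\<lambda>x. (Y n x - Y' x)\<^sup>2)))"],
       simp_all)
qed

section \<open>Gaussian laws and log-normal moments\<close>

context
  fixes T :: "'t measure" and Z :: "'t \<Rightarrow> real"
  assumes T: "prob_space T"
    and Z: "distributed T lborel Z (\<lambda>x. ennreal (std_normal_density x))"
begin

interpretation T: prob_space T by (fact T)

lemma Z_measurable [measurable]: "Z \<in> borel_measurable T"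
  using distributed_measurable[OF Z] by simp

lemma distr_Z: "distr T borel Z = std_normal_distribution"
  using distributed_distr_eq_density[OF Z] by (simp cong: distr_cong)

text \<open>
  For \<open>s = 0\<close> both sides are the point mass at \<open>m\<close>: representing the
  law as an affine image of one Gaussian variable covers the degenerate case.
\<close>
lemma normal_law_eq_distr:
  assumes "0 \<le> s"
  shows "normal_law m (s\<^sup>2) = distr T borel (\<lambda>x. m + s * Z x)"
proof (cases "s = 0")
  case True
  then show ?thesis by (simp add: normal_law_def)
next
  case False
  then have "distributed T lborel (\<lambda>x. m + s * Z x) (normal_density (m + s * 0) (\<bar>s\<bar> * 1))"
    using Z by (intro T.normal_density_affine) auto
  from distributed_distr_eq_density[OF this] False assms show ?thesis
    by (simp add: normal_law_def cong: distr_cong)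
qed

lemma char_normal_law:
  assumes "0 \<le> s"
  shows "char (normal_law m (s\<^sup>2)) t = exp (\<i> * (t * m) - s\<^sup>2 * t\<^sup>2 / 2)"
proof -
  have split: "iexp (t * (m + s * z)) = iexp (t * m) * iexp ((t * s) * z)" for z
    by (simp only: mult_exp_exp) (simp add: algebra_simps)
  have "char (normal_law m (s\<^sup>2)) t = (CLINT x|T. iexp (t * (m + s * Z x)))"
    unfolding normal_law_eq_distr[OF assms] char_def by (rule integral_distr) measurable
  also have "\<dots> = iexp (t * m) * (CLINT x|T. iexp ((t * s) * Z x))"
    unfolding split by (rule integral_mult_right_zero)
  also have "(CLINT x|T. iexp ((t * s) * Z x)) = char (distr T borel Z) (t * s)"
    unfolding char_def by (rule integral_distr[symmetric]) measurable
  also have "\<dots> = exp (of_real (- (t * s)\<^sup>2 / 2))"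
    by (simp only: distr_Z char_std_normal_distribution exp_of_real)
  also have "iexp (t * m) * \<dots> = exp (\<i> * (t * m) - s\<^sup>2 * t\<^sup>2 / 2)"
    by (simp only: mult_exp_exp) (simp add: power_mult_distrib mult.commute)
  finally show ?thesis .
qed

text \<open>
  Completing the square: tilting the standard normal density by \<open>exp (s x)\<close> gives \<open>exp (s\<^sup>2 / 2)\<close> times
  the normal density with mean \<open>s\<close>.
\<close>
lemma exp_normal_moment:
  shows "integrable T (\<lambda>x. exp (s * Z x))" (is ?int)
    and "T.expectation (\<lambda>x. exp (s * Z x)) = exp (s\<^sup>2 / 2)" (is ?exp)
proof -
  have dens: "std_normal_density x * exp (s * x) = exp (s\<^sup>2 / 2) * normal_density s 1 x" for x
  proof -
    have "- x\<^sup>2 / 2 + s * x = s\<^sup>2 / 2 + (- (x - s)\<^sup>2 / 2)"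
      by (simp add: power2_diff field_simps)
    then have "exp (- x\<^sup>2 / 2) * exp (s * x) = exp (s\<^sup>2 / 2) * exp (- (x - s)\<^sup>2 / 2)"
      by (simp only: mult_exp_exp)
    then show ?thesis by (simp add: normal_density_def)
  qed
  have "integrable lborel (\<lambda>x. std_normal_density x * exp (s * x))"
    unfolding dens by (intro integrable_mult_right integrable_normal_density) simp
  then show ?int
    using distributed_integrable[OF Z, of "\<lambda>x. exp (s * x)"] by simp
  have "T.expectation (\<lambda>x. exp (s * Z x)) = (\<integral>x. std_normal_density x * exp (s * x) \<partial>lborel)"
    using distributed_integral[OF Z, of "\<lambda>x. exp (s * x)"] by simp
  also have "\<dots> = exp (s\<^sup>2 / 2)"
    unfolding dens by simp
  finally show ?exp .
qed

end

section \<open>Limit laws of the two statistics\<close>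

theorem lemma3p2:
  fixes S :: "'s measure" and X :: "'s \<Rightarrow> real"
    and M :: "nat \<Rightarrow> 'a measure" and Xs :: "nat \<Rightarrow> nat \<Rightarrow> 'a \<Rightarrow> real"
    and T :: "'t measure" and Z :: "'t \<Rightarrow> real"
    and d N :: "nat \<Rightarrow> nat" and lam c v :: real
  assumes S: "prob_space S"
    and X_rv: "X \<in> borel_measurable S"
    and X4: "integrable S (\<lambda>s. X s ^ 4)"
    and X_mean: "prob_space.expectation S X = 0"
    and X_second: "prob_space.expectation S (\<lambda>s. (X s)\<^sup>2) = 1"
    and v: "v = prob_space.expectation S (\<lambda>s. X s ^ 4) - 1"
    and d: "\<And>n. n \<ge> 1 \<Longrightarrow> 1 \<le> d n \<and> d n \<le> n"
    and N: "\<And>n. n \<ge> 1 \<Longrightarrow> N n \<ge> 1"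
    and lam: "lam \<ge> 0" "(\<lambda>n. (real (d n))\<^sup>2 / real n) \<longlonglongrightarrow> lam"
    and c: "c > 0" "(\<lambda>n. real (n choose d n) / real (N n)) \<longlonglongrightarrow> c"
    and M: "\<And>n. n \<ge> 1 \<Longrightarrow> prob_space (M n)"
    and indep: "\<And>n. n \<ge> 1 \<Longrightarrow> prob_space.indep_vars (M n) (\<lambda>_. borel) (Xs n) {1..n}"
    and copies: "\<And>n i. n \<ge> 1 \<Longrightarrow> i \<in> {1..n} \<Longrightarrow> distr (M n) borel (Xs n i) = distr S borel X"
    and T: "prob_space T"
    and Z: "distributed T lborel Z (\<lambda>x. ennreal (std_normal_density x))"
  defines "R_n \<equiv> \<lambda>n \<omega>. R_stat n (d n) (\<lambda>i. Xs n i \<omega>)"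
    and "P_n \<equiv> \<lambda>n \<omega>. P_stat n (d n) (\<lambda>i. Xs n i \<omega>)"
    and "R \<equiv> \<lambda>t. exp (sqrt (lam * v) * Z t - lam * v / 2)"
  shows
    "weak_conv_m (\<lambda>n. distr (M n) borel (\<lambda>\<omega>. ln (P_n n \<omega>)))
                 (normal_law (- (lam * v / 2)) (lam * v))
     \<and> (weak_conv_m (\<lambda>n. distr (M n) borel (R_n n)) (distr T borel R)
        \<and> converges_in_prob_const M (\<lambda>n \<omega>. R_n n \<omega> / P_n n \<omega>) 1)
     \<and> ((\<forall>n\<ge>1. integrable (M n) (\<lambda>\<omega>. (R_n n \<omega>)\<^sup>2)) \<and> integrable T (\<lambda>t. (R t)\<^sup>2)
        \<and> (\<lambda>n. wasserstein2 (distr (M n) borel (R_n n)) (distr T borel R)) \<longlonglongrightarrow> 0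
        \<and> (\<lambda>n. prob_space.expectation (M n) (\<lambda>\<omega>. (R_n n \<omega>)\<^sup>2)) \<longlonglongrightarrow> exp (lam * v))"
proof -
  interpret S: prob_space S by (fact S)
  interpret T: prob_space T by (fact T)
  note [measurable] = X_rv
  note Z_meas [measurable] = Z_measurable[OF T Z]

  define \<Delta> where "\<Delta> s = (X s)\<^sup>2 - 1" for s
  define D where "D n i \<omega> = (Xs n i \<omega>)\<^sup>2 - 1" for n i \<omega>
  define a where "a n = real (d n) / real n" for n
  define b where "b n k = real (d n choose k) / real (n choose k)" for n k

  have \<Delta>_meas [measurable]: "\<Delta> \<in> borel_measurable S" unfolding \<Delta>_def[abs_def] by measurable
  have X2: "integrable S (\<lambda>s. (X s)\<^sup>2)"
    by (rule S.square_integrable_imp_integrable) (simp_all add: X4 flip: power_mult)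
  have \<Delta>_square: "(\<Delta> s)\<^sup>2 = X s ^ 4 - 2 * (X s)\<^sup>2 + 1" for s
    by (simp add: \<Delta>_def power2_diff flip: power_mult)
  have \<Delta>_sq: "integrable S (\<lambda>s. (\<Delta> s)\<^sup>2)"
    using X4 X2 by (simp add: \<Delta>_square)
  have \<Delta>_mean: "S.expectation \<Delta> = 0"
    unfolding \<Delta>_def using X2 X_second by (simp add: S.prob_space)
  have \<Delta>_var: "S.expectation (\<lambda>s. (\<Delta> s)\<^sup>2) = v"
    unfolding \<Delta>_square using X4 X2 X_second v by (simp add: S.prob_space)
  have v_nonneg: "0 \<le> v" unfolding \<Delta>_var[symmetric] by simp
  define s where "s = sqrt (lam * v)"
  have s: "0 \<le> s" "s\<^sup>2 = lam * v" using lam(1) v_nonneg by (auto simp: s_def)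

  have Xs_meas: "Xs n i \<in> borel_measurable (M n)" if "n \<ge> 1" "i \<in> {1..n}" for n i
    using indep[OF that(1)] that(2) by (simp add: prob_space.indep_vars_def[OF M[OF that(1)]])
  have copy_integral: "integral\<^sup>L (M n) (\<lambda>\<omega>. g (Xs n i \<omega>)) = integral\<^sup>L S (\<lambda>s. g (X s))"
    "integrable (M n) (\<lambda>\<omega>. g (Xs n i \<omega>)) \<longleftrightarrow> integrable S (\<lambda>s. g (X s))"
    if "n \<ge> 1" "i \<in> {1..n}" and [measurable]: "g \<in> borel_measurable borel"
    for n i and g :: "real \<Rightarrow> real"
  proof -
    note [measurable] = Xs_meas[OF that(1,2)]
    show "integral\<^sup>L (M n) (\<lambda>\<omega>. g (Xs n i \<omega>)) = integral\<^sup>L S (\<lambda>s. g (X s))"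
      using arg_cong[OF copies[OF that(1,2)], of "\<lambda>\<mu>. integral\<^sup>L \<mu> g"] by (simp add: integral_distr)
    show "integrable (M n) (\<lambda>\<omega>. g (Xs n i \<omega>)) \<longleftrightarrow> integrable S (\<lambda>s. g (X s))"
      using arg_cong[OF copies[OF that(1,2)], of "\<lambda>\<mu>. integrable \<mu> g"]
      by (simp add: integrable_distr_eq)
  qed
  have centered: "independent_centered (M n) n (D n) v" if n: "n \<ge> 1" for n
  proof -
    interpret Mn: prob_space "M n" by (rule M[OF n])
    show ?thesis
    proof
      show "Mn.indep_vars (\<lambda>_. borel) (D n) {1..n}"
        unfolding D_def[abs_def] by (rule Mn.indep_vars_compose2[OF indep[OF n]]) measurable
      fix i assume i: "i \<in> {1..n}"
      show "integrable (M n) (\<lambda>\<omega>. (D n i \<omega>)\<^sup>2)"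
        using copy_integral(2)[OF n i, of "\<lambda>x. (x\<^sup>2 - 1)\<^sup>2"] \<Delta>_sq by (simp add: D_def \<Delta>_def)
      show "Mn.expectation (D n i) = 0"
        using copy_integral(1)[OF n i, of "\<lambda>x. x\<^sup>2 - 1"] \<Delta>_mean by (simp add: D_def[abs_def] \<Delta>_def[abs_def])
      show "Mn.expectation (\<lambda>\<omega>. (D n i \<omega>)\<^sup>2) = v"
        using copy_integral(1)[OF n i, of "\<lambda>x. (x\<^sup>2 - 1)\<^sup>2"] \<Delta>_var by (simp add: D_def \<Delta>_def)
    qed
  qed
  have P_level: "P_n n = independent_centered.level_sum n (D n) (\<lambda>k. a n ^ k)" if "n \<ge> 1" for n
    by (intro ext) (simp add: P_n_def P_stat_eq_sum independent_centered.level_sum_def[OF centered[OF that]] D_def a_def)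
  have R_level: "R_n n = independent_centered.level_sum n (D n) (b n)" if "n \<ge> 1" for n
    using d[OF that] by (intro ext)
      (simp add: R_n_def R_stat_eq_sum independent_centered.level_sum_def[OF centered[OF that]] D_def b_def)
  have P_meas: "P_n n \<in> borel_measurable (M n)" if "n \<ge> 1" for n
    unfolding P_level[OF that] by (rule independent_centered.level_sum_measurable[OF centered[OF that]])
  have R_meas: "R_n n \<in> borel_measurable (M n)" if "n \<ge> 1" for n
    unfolding R_level[OF that] by (rule independent_centered.level_sum_measurable[OF centered[OF that]])
  have R_sq: "integrable (M n) (\<lambda>\<omega>. (R_n n \<omega>)\<^sup>2)" if "n \<ge> 1" for n
    unfolding R_level[OF that] by (rule independent_centered.level_sum_square(1)[OF centered[OF that]])
  have diff_sq: "integrable (M n) (\<lambda>\<omega>. (R_n n \<omega> - P_n n \<omega>)\<^sup>2)" if "n \<ge> 1" for n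
    unfolding R_level[OF that] P_level[OF that] independent_centered.level_sum_diff[OF centered[OF that]]
    by (rule independent_centered.level_sum_square(1)[OF centered[OF that]])

  have R_moment: "(\<lambda>n. integral\<^sup>L (M n) (\<lambda>\<omega>. (R_n n \<omega>)\<^sup>2)) \<longlonglongrightarrow> exp (lam * v)"
  proof (rule Lim_transform_eventually)
    show "(\<lambda>n. \<Sum>k\<le>n. (real (d n choose k))\<^sup>2 / real (n choose k) * v ^ k) \<longlonglongrightarrow> exp (lam * v)"
      using lam(2) d v_nonneg by (intro sum_square_binomial_ratio_limit) auto
    show "\<forall>\<^sub>F n in sequentially. (\<Sum>k\<le>n. (real (d n choose k))\<^sup>2 / real (n choose k) * v ^ k)
        = integral\<^sup>L (M n) (\<lambda>\<omega>. (R_n n \<omega>)\<^sup>2)"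
      using eventually_ge_at_top[of 1]
    proof eventually_elim
      case (elim n)
      show ?case
        unfolding R_level[OF elim] independent_centered.level_sum_square(2)[OF centered[OF elim]]
        by (intro sum.cong) (simp_all add: b_def power2_eq_square)
    qed
  qed
  \<comment> \<open>The squared \<open>L\<^sup>2\<close> distance of the two statistics, controlled by the gap of their second moments.\<close>
  define L where "L n = integral\<^sup>L (M n) (\<lambda>\<omega>. (R_n n \<omega> - P_n n \<omega>)\<^sup>2)" for n
  have L_nonneg: "0 \<le> L n" for n by (simp add: L_def)
  have na2: "real n * (a n)\<^sup>2 = (real (d n))\<^sup>2 / real n" for n
    by (simp add: a_def power2_eq_square)
  have na2_lim: "(\<lambda>n. real n * (a n)\<^sup>2) \<longlonglongrightarrow> lam"
    using lam(2) by (simp add: na2)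
  have L_lim: "L \<longlonglongrightarrow> 0"
  proof (rule tendsto_sandwich[where f = "\<lambda>_. 0" and h = "\<lambda>n. exp (real n * (a n)\<^sup>2 * v)
      - integral\<^sup>L (M n) (\<lambda>\<omega>. (R_n n \<omega>)\<^sup>2)"])
    show "(\<lambda>n. exp (real n * (a n)\<^sup>2 * v) - integral\<^sup>L (M n) (\<lambda>\<omega>. (R_n n \<omega>)\<^sup>2)) \<longlonglongrightarrow> 0"
      by (rule tendsto_eq_rhs[OF tendsto_diff[OF tendsto_exp[OF tendsto_mult_right[OF na2_lim]] R_moment]]) simp
    show "\<forall>\<^sub>F n in sequentially. L n \<le> exp (real n * (a n)\<^sup>2 * v) - integral\<^sup>L (M n) (\<lambda>\<omega>. (R_n n \<omega>)\<^sup>2)"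
      using eventually_ge_at_top[of 1]
    proof eventually_elim
      case (elim n)
      interpret independent_centered "M n" n "D n" v by (rule centered[OF elim])
      have "b n k \<le> a n ^ k" for k
        using binomial_ratio_le_power[of "d n" n k] d[OF elim] by (simp add: b_def a_def)
      then have "expectation (\<lambda>\<omega>. (P_n n \<omega> - R_n n \<omega>)\<^sup>2)
          \<le> expectation (\<lambda>\<omega>. (P_n n \<omega>)\<^sup>2) - expectation (\<lambda>\<omega>. (R_n n \<omega>)\<^sup>2)"
        unfolding P_level[OF elim] R_level[OF elim]
        using v_nonneg by (intro level_sum_L2_gap) (auto simp: b_def)
      moreover have "expectation (\<lambda>\<omega>. (P_n n \<omega>)\<^sup>2) \<le> exp (real n * (a n)\<^sup>2 * v)"
        unfolding P_level[OF elim] using v_nonneg by (rule level_sum_power_second_moment_le)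
      ultimately show ?case by (simp add: L_def power2_commute[of "R_n n _"])
    qed
  qed (use L_nonneg in auto)

  have a_nonneg: "0 \<le> a n" for n by (simp add: a_def)
  have a_lim: "a \<longlonglongrightarrow> 0"
    using ratio_tendsto_0[OF lam(2)] by (simp add: a_def[abs_def])
  have "\<forall>\<^sub>F n in sequentially. a n < 1/2"
    using a_lim by (rule order_tendstoD) simp
  then have large: "\<forall>\<^sub>F n in sequentially. n \<ge> 1 \<and> a n \<le> 1/2"
    using eventually_ge_at_top[of 1] by eventually_elim simp
  have factor_pos: "0 < 1 + a n * (x\<^sup>2 - 1)" if "a n \<le> 1/2" for n and x :: real
  proof -
    have "a n * -1 \<le> a n * (x\<^sup>2 - 1)" by (intro mult_left_mono a_nonneg) simp
    with that show ?thesis by linarith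
  qed
  have P_prod: "P_n n \<omega> = (\<Prod>i\<in>{1..n}. 1 + a n * D n i \<omega>)" for n \<omega>
    by (simp add: P_n_def P_stat_def a_def D_def)
  have P_pos: "0 < P_n n \<omega>" if "a n \<le> 1/2" for n \<omega>
    using factor_pos[OF that] by (simp add: P_prod D_def prod_pos)

  \<comment> \<open>The logarithm turns the product into a sum of independent terms with the same law as \<open>ln (1 + a n * \<Delta>)\<close>.\<close>
  have log_char: "char (distr (M n) borel (\<lambda>\<omega>. ln (P_n n \<omega>))) t
      = char (distr S borel (\<lambda>s. ln (1 + a n * \<Delta> s))) t ^ n"
    if "n \<ge> 1 \<and> a n \<le> 1/2" for n t
  proof -
    from that have n: "n \<ge> 1" and a: "a n \<le> 1/2" by auto
    interpret Mn: prob_space "M n" by (rule M[OF n])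
    define g where "g x = ln (1 + a n * (x\<^sup>2 - 1))" for x
    have [measurable]: "g \<in> borel_measurable borel" unfolding g_def[abs_def] by measurable
    have "ln (P_n n \<omega>) = (\<Sum>i\<in>{1..n}. g (Xs n i \<omega>))" for \<omega>
      unfolding P_prod g_def D_def using less_imp_neq[OF factor_pos[OF a], symmetric] factor_pos[OF a] by (intro ln_prod) auto
    moreover have "Mn.indep_vars (\<lambda>_. borel) (\<lambda>i \<omega>. g (Xs n i \<omega>)) {1..n}"
      by (rule Mn.indep_vars_compose2[OF indep[OF n]]) measurable
    ultimately have "char (distr (M n) borel (\<lambda>\<omega>. ln (P_n n \<omega>))) t
        = (\<Prod>i\<in>{1..n}. char (distr (M n) borel (\<lambda>\<omega>. g (Xs n i \<omega>))) t)"
      by (simp only: Mn.char_distr_sum)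
    also have "\<dots> = (\<Prod>i\<in>{1..n}. char (distr S borel (\<lambda>s. g (X s))) t)"
    proof (rule prod.cong[OF refl])
      fix i assume i: "i \<in> {1..n}"
      note [measurable] = Xs_meas[OF n i]
      have "distr (distr (M n) borel (Xs n i)) borel g = distr (distr S borel X) borel g"
        by (simp only: copies[OF n i])
      then show "char (distr (M n) borel (\<lambda>\<omega>. g (Xs n i \<omega>))) t = char (distr S borel (\<lambda>s. g (X s))) t"
        by (simp add: distr_distr comp_def)
    qed
    finally show ?thesis by (simp add: g_def \<Delta>_def)
  qed

  \<comment> \<open>Set to 0 where \<open>a\<close> exceeds \<open>1/2\<close>, so that the bound holds for every \<open>n\<close>; it agrees with \<open>a\<close> for all large \<open>n\<close>.\<close>
  define a' where "a' n = (if a n \<le> 1/2 then a n else 0)" for n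
  have a'_eq: "\<forall>\<^sub>F n in sequentially. a n = a' n"
    using large by eventually_elim (simp add: a'_def)
  have log_char_lim: "(\<lambda>n. char (distr (M n) borel (\<lambda>\<omega>. ln (P_n n \<omega>))) t)
      \<longlonglongrightarrow> char (normal_law (- (lam * v / 2)) (lam * v)) t" for t
  proof (rule Lim_transform_eventually)
    let ?\<phi> = "\<lambda>n. char (distr S borel (\<lambda>s. ln (1 + a' n * \<Delta> s))) t"
    have "(\<lambda>n. ?\<phi> n ^ n) \<longlonglongrightarrow> exp (- (lam * v) * (t\<^sup>2 + \<i> * t) / 2)"
    proof (rule power_tendsto_exp_complex)
      have "real_distribution (distr S borel (\<lambda>s. ln (1 + a' n * \<Delta> s)))" for n
        by (rule S.real_distribution_distr) measurable
      then show "norm (?\<phi> n) \<le> 1" for n by (rule real_distribution.cmod_char_le_1)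
      show "(\<lambda>n. of_nat n * (?\<phi> n - 1)) \<longlonglongrightarrow> - (lam * v) * (t\<^sup>2 + \<i> * t) / 2"
      proof (rule S.log_increment_char_limit[OF \<Delta>_meas \<Delta>_sq \<Delta>_mean \<Delta>_var])
        show "a' \<longlonglongrightarrow> 0" using a_lim a'_eq by (rule Lim_transform_eventually)
        show "(\<lambda>n. real n * (a' n)\<^sup>2) \<longlonglongrightarrow> lam"
          using na2_lim by (rule Lim_transform_eventually) (use a'_eq in eventually_elim, simp)
      qed (auto simp: \<Delta>_def a'_def a_nonneg)
      show "Re (- (lam * v) * (t\<^sup>2 + \<i> * t) / 2) \<le> 0"
        using lam(1) v_nonneg by (simp flip: of_real_power of_real_mult)
    qed
    also have "exp (- (lam * v) * (t\<^sup>2 + \<i> * t) / 2) = char (normal_law (- (lam * v / 2)) (lam * v)) t"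
      using char_normal_law[OF T Z s(1), of "- (lam * v / 2)" t]
      by (simp add: s(2) algebra_simps diff_divide_distrib flip: of_real_power of_real_mult)
    finally show "(\<lambda>n. ?\<phi> n ^ n) \<longlonglongrightarrow> char (normal_law (- (lam * v / 2)) (lam * v)) t" .
    show "\<forall>\<^sub>F n in sequentially. ?\<phi> n ^ n = char (distr (M n) borel (\<lambda>\<omega>. ln (P_n n \<omega>))) t"
      using large a'_eq by eventually_elim (simp add: log_char)
  qed
  have normal_distr: "normal_law (- (lam * v / 2)) (lam * v) = distr T borel (\<lambda>t. - (lam * v / 2) + s * Z t)"
    using normal_law_eq_distr[OF T Z s(1), of "- (lam * v / 2)"] by (simp add: s(2))
  have log_real: "\<forall>\<^sub>F n in sequentially. real_distribution (distr (M n) borel (\<lambda>\<omega>. ln (P_n n \<omega>)))"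
    using eventually_ge_at_top[of 1]
    by eventually_elim (intro prob_space.real_distribution_distr M borel_measurable_ln P_meas)
  have normal_real: "real_distribution (normal_law (- (lam * v / 2)) (lam * v))"
    unfolding normal_distr by (rule T.real_distribution_distr) measurable
  have conv_log: "weak_conv_m (\<lambda>n. distr (M n) borel (\<lambda>\<omega>. ln (P_n n \<omega>)))
      (normal_law (- (lam * v / 2)) (lam * v))"
    using log_real normal_real log_char_lim by (rule levy_continuity_eventually)

  have R_meas_T [measurable]: "R \<in> borel_measurable T" unfolding R_def by measurable
  have R_real: "real_distribution (distr T borel R)" by (rule T.real_distribution_distr) measurable
  \<comment> \<open>For large \<open>n\<close> the product is positive, hence it is \<open>exp\<close> of its logarithm; test the law of the logarithm with \<open>\<lambda>x. iexp (t * exp x)\<close>.\<close>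
  have P_char_lim: "(\<lambda>n. char (distr (M n) borel (P_n n)) t) \<longlonglongrightarrow> char (distr T borel R) t" for t
  proof -
    let ?f = "\<lambda>x. iexp (t * exp x)"
    have "(\<lambda>n. integral\<^sup>L (distr (M n) borel (\<lambda>\<omega>. ln (P_n n \<omega>))) ?f)
        \<longlonglongrightarrow> integral\<^sup>L (normal_law (- (lam * v / 2)) (lam * v)) ?f"
      using log_real normal_real conv_log
      by (rule weak_conv_m_imp_integral_tendsto[where B = 1]) (auto intro!: continuous_intros)
    also have "integral\<^sup>L (normal_law (- (lam * v / 2)) (lam * v)) ?f = char (distr T borel R) t"
      unfolding normal_distr char_def R_def s_def by (simp add: integral_distr)
    finally show ?thesis
    proof (rule Lim_transform_eventually)
      show "\<forall>\<^sub>F n in sequentially. integral\<^sup>L (distr (M n) borel (\<lambda>\<omega>. ln (P_n n \<omega>))) ?f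
          = char (distr (M n) borel (P_n n)) t"
        using large
      proof eventually_elim
        case (elim n)
        note [measurable] = P_meas[of n]
        from elim show ?case using P_pos[of n] by (simp add: char_def integral_distr)
      qed
    qed
  qed
  \<comment> \<open>The characteristic functions of \<open>R_n\<close> and \<open>P_n\<close> differ by at most \<open>\<bar>t\<bar> * sqrt (L n)\<close>.\<close>
  have R_char_lim: "(\<lambda>n. char (distr (M n) borel (R_n n)) t) \<longlonglongrightarrow> char (distr T borel R) t" for t
  proof -
    have "(\<lambda>n. char (distr (M n) borel (R_n n)) t - char (distr (M n) borel (P_n n)) t) \<longlonglongrightarrow> 0"
    proof (rule Lim_null_comparison)
      show "(\<lambda>n. \<bar>t\<bar> * sqrt (L n)) \<longlonglongrightarrow> 0"
        using tendsto_mult_left[OF tendsto_real_sqrt[OF L_lim], of "\<bar>t\<bar>"] by simp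
      show "\<forall>\<^sub>F n in sequentially. norm (char (distr (M n) borel (R_n n)) t
          - char (distr (M n) borel (P_n n)) t) \<le> \<bar>t\<bar> * sqrt (L n)"
        using eventually_ge_at_top[of 1]
      proof eventually_elim
        case (elim n)
        interpret Mn: prob_space "M n" by (rule M[OF elim])
        note [measurable] = P_meas[OF elim] R_meas[OF elim]
        have "integrable (M n) (\<lambda>\<omega>. R_n n \<omega> - P_n n \<omega>)"
          using diff_sq[OF elim] by (rule Mn.square_integrable_imp_integrable[rotated]) measurable
        then have "norm (char (distr (M n) borel (R_n n)) t - char (distr (M n) borel (P_n n)) t)
            \<le> \<bar>t\<bar> * Mn.expectation (\<lambda>\<omega>. \<bar>R_n n \<omega> - P_n n \<omega>\<bar>)"
          by (intro Mn.char_diff_le integrable_abs) measurable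
        also have "\<dots> \<le> \<bar>t\<bar> * sqrt (L n)"
          unfolding L_def using diff_sq[OF elim]
          by (intro mult_left_mono Mn.expectation_abs_le_sqrt) (auto intro: borel_measurable_diff P_meas R_meas elim)
        finally show ?case .
      qed
    qed
    from tendsto_add[OF this P_char_lim[of t]] show ?thesis by simp
  qed
  have R_n_real: "real_distribution (distr (M n) borel (R_n n))" if "n \<ge> 1" for n
    using that by (intro prob_space.real_distribution_distr M R_meas)
  have conv_R: "weak_conv_m (\<lambda>n. distr (M n) borel (R_n n)) (distr T borel R)"
    using R_real R_char_lim
    by (intro levy_continuity_eventually eventually_sequentiallyI[of 1] R_n_real)

  have ratio: "converges_in_prob_const M (\<lambda>n \<omega>. R_n n \<omega> / P_n n \<omega>) 1"
    unfolding converges_in_prob_const_def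
  proof (intro allI impI)
    fix \<epsilon> :: real assume \<epsilon>: "0 < \<epsilon>"
    \<comment> \<open>Large enough that \<open>L n / \<eta> n \<le> sqrt (L n)\<close>, yet null; the summand \<open>1 / n\<close> keeps it positive if \<open>L n = 0\<close>.\<close>
    define \<eta> where "\<eta> n = sqrt (L n) + 1 / real n" for n
    have \<eta>_lim: "\<eta> \<longlonglongrightarrow> 0"
      unfolding \<eta>_def[abs_def]
      using tendsto_add[OF tendsto_real_sqrt[OF L_lim] lim_1_over_n] by simp
    let ?bound = "\<lambda>n. (sqrt (L n) + \<eta> n * exp (8 * (real n * (a n)\<^sup>2 * v))) / (2 * \<epsilon>)"
    show "(\<lambda>n. measure (M n) {\<omega> \<in> space (M n). \<bar>R_n n \<omega> / P_n n \<omega> - 1\<bar> > \<epsilon>}) \<longlonglongrightarrow> 0"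
    proof (rule tendsto_sandwich[where f = "\<lambda>_. 0" and h = ?bound])
      have "?bound \<longlonglongrightarrow> (sqrt 0 + 0 * exp (8 * (lam * v))) / (2 * \<epsilon>)"
        using \<epsilon> by (intro tendsto_intros L_lim \<eta>_lim na2_lim) simp
      then show "?bound \<longlonglongrightarrow> 0" by simp
      show "\<forall>\<^sub>F n in sequentially.
          measure (M n) {\<omega> \<in> space (M n). \<bar>R_n n \<omega> / P_n n \<omega> - 1\<bar> > \<epsilon>} \<le> ?bound n"
        using large
      proof eventually_elim
        case (elim n)
        then have n: "n \<ge> 1" and an: "a n \<le> 1/2" by auto
        interpret independent_centered "M n" n "D n" v by (rule centered[OF n])
        have \<eta>_pos: "0 < \<eta> n" using n L_nonneg[of n] by (simp add: \<eta>_def add_nonneg_pos)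
        have ge: "-1 \<le> D n i \<omega>" for i \<omega> by (simp add: D_def)
        have "prob {\<omega> \<in> space (M n). \<bar>R_n n \<omega> / P_n n \<omega> - 1\<bar> > \<epsilon>}
            \<le> (L n / \<eta> n + \<eta> n * expectation (\<lambda>\<omega>. 1 / (P_n n \<omega>)\<^sup>2)) / (2 * \<epsilon>)"
          unfolding L_def
        proof (rule ratio_deviation_bound)
          show "P_n n \<omega> \<noteq> 0" for \<omega> using P_pos[OF an, of \<omega>] by simp
          show "integrable (M n) (\<lambda>\<omega>. 1 / (P_n n \<omega>)\<^sup>2)"
            unfolding P_prod using a_nonneg an ge by (rule inverse_square_product)
        qed (use n R_meas P_meas diff_sq \<eta>_pos \<epsilon> in auto)
        also have "\<dots> \<le> ?bound n"
        proof (intro divide_right_mono add_mono mult_left_mono)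
          have "L n = sqrt (L n) * sqrt (L n)" using L_nonneg by simp
          also have "\<dots> \<le> sqrt (L n) * \<eta> n" using L_nonneg by (intro mult_left_mono) (auto simp: \<eta>_def)
          finally show "L n / \<eta> n \<le> sqrt (L n)" using \<eta>_pos by (simp add: divide_le_eq)
          show "expectation (\<lambda>\<omega>. 1 / (P_n n \<omega>)\<^sup>2) \<le> exp (8 * (real n * (a n)\<^sup>2 * v))"
            unfolding P_prod using a_nonneg an ge by (rule inverse_square_product)
        qed (use \<epsilon> \<eta>_pos in auto)
        finally show ?case .
      qed
    qed auto
  qed

  have R_square: "(R t)\<^sup>2 = exp (- (lam * v)) * exp (2 * s * Z t)" for t
    by (simp add: R_def s_def power2_eq_square flip: exp_add)
  have R_int: "integrable T (\<lambda>t. (R t)\<^sup>2)"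
    unfolding R_square by (intro integrable_mult_right exp_normal_moment[OF T Z])
  have R_second: "T.expectation (\<lambda>t. (R t)\<^sup>2) = exp (lam * v)"
  proof -
    have "T.expectation (\<lambda>t. (R t)\<^sup>2) = exp (- (lam * v)) * exp ((2 * s)\<^sup>2 / 2)"
      unfolding R_square by (simp only: integral_mult_right_zero exp_normal_moment[OF T Z])
    also have "\<dots> = exp (- (lam * v) + (2 * s)\<^sup>2 / 2)" by (rule mult_exp_exp)
    also have "(2 * s)\<^sup>2 / 2 = 2 * (lam * v)" by (simp add: power_mult_distrib s(2))
    finally show ?thesis by simp
  qed
  have wasserstein: "(\<lambda>n. wasserstein2 (distr (M n) borel (R_n n)) (distr T borel R)) \<longlonglongrightarrow> 0"
  proof -
    \<comment> \<open>Nothing is known about \<open>M 0\<close>, so the limit law stands in at index 0.\<close>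
    define \<mu> where "\<mu> n = (if n \<ge> 1 then distr (M n) borel (R_n n) else distr T borel R)" for n
    have \<mu>_eq: "\<forall>\<^sub>F n in sequentially. distr (M n) borel (R_n n) = \<mu> n"
      using eventually_ge_at_top[of 1] by eventually_elim (simp add: \<mu>_def)
    have R_T: "integrable (distr T borel R) (\<lambda>x. x\<^sup>2)"
      using R_int by (simp add: integrable_distr_eq)
    have "(\<lambda>n. wasserstein2 (\<mu> n) (distr T borel R)) \<longlonglongrightarrow> 0"
    proof (rule wasserstein2_tendsto_0)
      show "real_distribution (\<mu> n)" for n using R_n_real R_real by (simp add: \<mu>_def)
      show "weak_conv_m \<mu> (distr T borel R)" using \<mu>_eq conv_R by (rule weak_conv_m_eventually_cong)
      show "integrable (\<mu> n) (\<lambda>x. x\<^sup>2)" for n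
        using R_sq[of n] R_T R_meas[of n] by (simp add: \<mu>_def integrable_distr_eq)
      have "integral\<^sup>L (distr T borel R) (\<lambda>x. x\<^sup>2) = exp (lam * v)"
        using R_second by (simp add: integral_distr)
      moreover have "\<forall>\<^sub>F n in sequentially. integral\<^sup>L (M n) (\<lambda>\<omega>. (R_n n \<omega>)\<^sup>2) = integral\<^sup>L (\<mu> n) (\<lambda>x. x\<^sup>2)"
        using eventually_ge_at_top[of 1]
        by eventually_elim (simp add: \<mu>_def integral_distr R_meas)
      ultimately show "(\<lambda>n. integral\<^sup>L (\<mu> n) (\<lambda>x. x\<^sup>2)) \<longlonglongrightarrow> integral\<^sup>L (distr T borel R) (\<lambda>x. x\<^sup>2)"
        using Lim_transform_eventually[OF R_moment] by simp
    qed (use R_real R_T in auto)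
    then show ?thesis
      by (rule Lim_transform_eventually) (use \<mu>_eq in eventually_elim, simp)
  qed

  show ?thesis
    using conv_log conv_R ratio R_sq R_int wasserstein R_moment by blast
qed

end
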